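(* The systems $\mathcal{D}$ and $\mathcal{K}$ are equivalent: a sequent $\Gamma\vdash G$ has a proof in $\mathcal{D}$ if and only if it has a proof in $\mathcal{K}$.
   Context: Propositions are first-order formulas built from atomic propositions $P(t_1,\dots,t_k)$ (predicate symbol applied to terms; $\top,\bot$ are not atomic), $\top$, $\bot$, $\wedge$, $\vee$, $\Rightarrow$, $\forall$, $\exists$. Sequents are $\Gamma\vdash G$ with $\Gamma$ a finite multiset of propositions and $G$ a proposition; $t$ below ranges over arbitrary terms. Common rules of $\mathcal{K}$ and $\mathcal{D}$: axiom $\Gamma,P\vdash P$ ($P$ atomic); $\top$-right $\Gamma\vdash\top$; $\bot$-left $\Gamma,\bot\vdash G$; $\wedge$-left (from $\Gamma,A,B\vdash G$ infer $\Gamma,A\wedge B\vdash G$); $\wedge$-right (from $\Gamma\vdash A$, $\Gamma\vdash B$ infer $\Gamma\vdash A\wedge B$); $\vee$-left (from $\Gamma,A\vdash G$, $\Gamma,B\vdash G$ infer $\Gamma,A\vee B\vdash G$); $\vee$-right (from $\Gamma\vdash A$, or from $\Gamma\vdash B$, infer $\Gamma\vdash A\vee B$); $\Rightarrow$-right (from $\Gamma,A\vdash B$ infer $\Gamma\vdash A\Rightarrow B$); $\forall$-right (from $\Gamma\vdash A$ infer $\Gamma\vdash\forall x\,A$, $x$ not free in $\Gamma$); contr-$\forall$-left (from $\Gamma,\forall x\,A,(t/x)A\vdash G$ infer $\Gamma,\forall x\,A\vdash G$); $\exists$-left (from $\Gamma,A\vdash G$ infer $\Gamma,\exists x\,A\vdash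 G$, $x$ not free in $\Gamma,G$); $\exists$-right (from $\Gamma\vdash(t/x)A$ infer $\Gamma\vdash\exists x\,A$). $\mathcal{K}$ consists of these rules plus contr-$\Rightarrow$-left (from $\Gamma,A\Rightarrow B\vdash A$ and $\Gamma,B\vdash G$ infer $\Gamma,A\Rightarrow B\vdash G$). $\mathcal{D}$ consists of the common rules plus: $\Rightarrow$-left$_{axiom}$ (from $\Gamma,P,B\vdash G$ infer $\Gamma,P,P\Rightarrow B\vdash G$, $P$ atomic); $\Rightarrow$-left$_\top$ (from $\Gamma,B\vdash G$ infer $\Gamma,\top\Rightarrow B\vdash G$); $\Rightarrow$-left$_\wedge$ (from $\Gamma,C\Rightarrow B\vdash C$, $\Gamma,D\Rightarrow B\vdash D$, $\Gamma,B\vdash G$ infer $\Gamma,(C\wedge D)\Rightarrow B\vdash G$); two $\Rightarrow$-left$_\vee$ rules (from $\Gamma,C\Rightarrow B,D\Rightarrow B\vdash C$ and $\Gamma,B\vdash G$, resp. from $\Gamma,C\Rightarrow B,D\Rightarrow B\vdash D$ and $\Gamma,B\vdash G$, infer $\Gamma,(C\vee D)\Rightarrow B\vdash G$); $\Rightarrow$-left$_\Rightarrow$ (from $\Gamma,D\Rightarrow B,C\vdash D$ and $\Gamma,B\vdash G$ infer $\Gamma,(C\Rightarrow D)\Rightarrow B\vdash G$); $\Rightarrow$-left$_\forall$ (from $\Gamma,(\forall x\,C)\Rightarrow B\vdash C$ and $\Gamma,B\vdash G$ infer $\Gamma,(\forall x\,C)\Rightarrow B\vdash G$, $x$ not free in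 $\Gamma,B$); $\Rightarrow$-left$_\exists$ (from $\Gamma,(\exists x\,C)\Rightarrow B\vdash(t/x)C$ and $\Gamma,B\vdash G$ infer $\Gamma,(\exists x\,C)\Rightarrow B\vdash G$). *)

theory Defs
  imports Main "HOL-Library.Multiset"
begin

text \<open>
  Propositions are identified up to renaming of bound variables. Alpha-equivalence classes are
  represented by de Bruijn terms: variables are natural numbers, and under \<open>k\<close> quantifiers the
  index \<open>k + n\<close> denotes the variable \<open>n\<close>. The usual notation with named variables is recovered by
  the operations \<open>all x A\<close>, \<open>ex x A\<close> and \<open>inst t x A\<close> below, and the inference rules are stated
  with these only.
\<close>

datatype 'f tm = Var nat | Fun 'f "'f tm list"

datatype ('f, 'p) fm =
    Atom 'p "'f tm list"
  | Top
  | Bot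
  | Conj "('f, 'p) fm" "('f, 'p) fm" (infixr \<open>\<^bold>\<and>\<close> 75)
  | Disj "('f, 'p) fm" "('f, 'p) fm" (infixr \<open>\<^bold>\<or>\<close> 73)
  | Imp "('f, 'p) fm" "('f, 'p) fm" (infixr \<open>\<^bold>\<Rightarrow>\<close> 71)
  | Forall "('f, 'p) fm"
  | Exists "('f, 'p) fm"

text \<open>
  A language is given by its function and predicate symbols, each paired with its arity.
\<close>

primrec wf_tm :: "('f \<times> nat) set \<Rightarrow> 'f tm \<Rightarrow> bool" where
  "wf_tm F (Var n) = True"
| "wf_tm F (Fun f ts) = ((f, length ts) \<in> F \<and> list_all (wf_tm F) ts)"

primrec wf_fm :: "('f \<times> nat) set \<Rightarrow> ('p \<times> nat) set \<Rightarrow> ('f, 'p) fm \<Rightarrow> bool" where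
  "wf_fm F P (Atom p ts) = ((p, length ts) \<in> P \<and> list_all (wf_tm F) ts)"
| "wf_fm F P Top = True"
| "wf_fm F P Bot = True"
| "wf_fm F P (A \<^bold>\<and> B) = (wf_fm F P A \<and> wf_fm F P B)"
| "wf_fm F P (A \<^bold>\<or> B) = (wf_fm F P A \<and> wf_fm F P B)"
| "wf_fm F P (A \<^bold>\<Rightarrow> B) = (wf_fm F P A \<and> wf_fm F P B)"
| "wf_fm F P (Forall A) = wf_fm F P A"
| "wf_fm F P (Exists A) = wf_fm F P A"

primrec fv_tm :: "'f tm \<Rightarrow> nat set" where
  "fv_tm (Var n) = {n}"
| "fv_tm (Fun f ts) = \<Union> (set (map fv_tm ts))"

primrec fv :: "('f, 'p) fm \<Rightarrow> nat set" where
  "fv (Atom p ts) = (\<Union>t\<in>set ts. fv_tm t)"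
| "fv Top = {}"
| "fv Bot = {}"
| "fv (A \<^bold>\<and> B) = fv A \<union> fv B"
| "fv (A \<^bold>\<or> B) = fv A \<union> fv B"
| "fv (A \<^bold>\<Rightarrow> B) = fv A \<union> fv B"
| "fv (Forall A) = {n. Suc n \<in> fv A}"
| "fv (Exists A) = {n. Suc n \<in> fv A}"

definition fv_ctx :: "('f, 'p) fm multiset \<Rightarrow> nat set" where
  "fv_ctx \<Gamma> = (\<Union>A\<in>set_mset \<Gamma>. fv A)"

primrec subst_tm :: "(nat \<Rightarrow> 'f tm) \<Rightarrow> 'f tm \<Rightarrow> 'f tm" where
  "subst_tm s (Var n) = s n"
| "subst_tm s (Fun f ts) = Fun f (map (subst_tm s) ts)"

definition lift_subst :: "(nat \<Rightarrow> 'f tm) \<Rightarrow> nat \<Rightarrow> 'f tm" where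
  "lift_subst s n = (case n of 0 \<Rightarrow> Var 0 | Suc m \<Rightarrow> subst_tm (\<lambda>i. Var (Suc i)) (s m))"

primrec subst_fm :: "(nat \<Rightarrow> 'f tm) \<Rightarrow> ('f, 'p) fm \<Rightarrow> ('f, 'p) fm" where
  "subst_fm s (Atom p ts) = Atom p (map (subst_tm s) ts)"
| "subst_fm s Top = Top"
| "subst_fm s Bot = Bot"
| "subst_fm s (A \<^bold>\<and> B) = subst_fm s A \<^bold>\<and> subst_fm s B"
| "subst_fm s (A \<^bold>\<or> B) = subst_fm s A \<^bold>\<or> subst_fm s B"
| "subst_fm s (A \<^bold>\<Rightarrow> B) = (subst_fm s A \<^bold>\<Rightarrow> subst_fm s B)"
| "subst_fm s (Forall A) = Forall (subst_fm (lift_subst s) A)"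
| "subst_fm s (Exists A) = Exists (subst_fm (lift_subst s) A)"

definition bind :: "nat \<Rightarrow> ('f, 'p) fm \<Rightarrow> ('f, 'p) fm" where
  "bind x A = subst_fm (\<lambda>n. if n = x then Var 0 else Var (Suc n)) A"

text \<open>
  \<open>all x A\<close> and \<open>ex x A\<close> are the quantifications of the named variable \<open>x\<close> in \<open>A\<close>, and
  \<open>inst t x A\<close> is the capture-avoiding substitution \<open>(t/x)A\<close>.
\<close>

definition all :: "nat \<Rightarrow> ('f, 'p) fm \<Rightarrow> ('f, 'p) fm" where
  "all x A = Forall (bind x A)"

definition ex :: "nat \<Rightarrow> ('f, 'p) fm \<Rightarrow> ('f, 'p) fm" where
  "ex x A = Exists (bind x A)"

definition inst :: "'f tm \<Rightarrow> nat \<Rightarrow> ('f, 'p) fm \<Rightarrow> ('f, 'p) fm" where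
  "inst t x A = subst_fm (Var(x := t)) A"

text \<open>
  The facts \<open>fv_all\<close>, \<open>all_alpha\<close>, \<open>inst_all\<close> and \<open>Forall_is_all\<close> (and their counterparts for
  \<open>ex\<close>) confirm that these operations obey the laws of named syntax modulo alpha-equivalence.
\<close>

lemma subst_tm_cong: "(\<And>n. n \<in> fv_tm t \<Longrightarrow> s n = s' n) \<Longrightarrow> subst_tm s t = subst_tm s' t"
  by (induction t) auto

lemma lift_subst_cong:
  "(\<And>n. Suc n \<in> M \<Longrightarrow> s n = s' n) \<Longrightarrow> m \<in> M \<Longrightarrow> lift_subst s m = lift_subst s' m"
  by (cases m) (simp_all add: lift_subst_def)

lemma subst_fm_cong: "(\<And>n. n \<in> fv A \<Longrightarrow> s n = s' n) \<Longrightarrow> subst_fm s A = subst_fm s' A"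
proof (induction A arbitrary: s s')
  case (Atom p ts)
  then show ?case by (auto intro!: subst_tm_cong)
next
  case (Conj A B)
  have "subst_fm s A = subst_fm s' A" by (rule Conj.IH(1)) (simp add: Conj.prems)
  moreover have "subst_fm s B = subst_fm s' B" by (rule Conj.IH(2)) (simp add: Conj.prems)
  ultimately show ?case by simp
next
  case (Disj A B)
  have "subst_fm s A = subst_fm s' A" by (rule Disj.IH(1)) (simp add: Disj.prems)
  moreover have "subst_fm s B = subst_fm s' B" by (rule Disj.IH(2)) (simp add: Disj.prems)
  ultimately show ?case by simp
next
  case (Imp A B)
  have "subst_fm s A = subst_fm s' A" by (rule Imp.IH(1)) (simp add: Imp.prems)
  moreover have "subst_fm s B = subst_fm s' B" by (rule Imp.IH(2)) (simp add: Imp.prems)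
  ultimately show ?case by simp
next
  case (Forall A)
  have "subst_fm (lift_subst s) A = subst_fm (lift_subst s') A"
    by (rule Forall.IH, rule lift_subst_cong[of "fv A"]) (simp_all add: Forall.prems)
  then show ?case by simp
next
  case (Exists A)
  have "subst_fm (lift_subst s) A = subst_fm (lift_subst s') A"
    by (rule Exists.IH, rule lift_subst_cong[of "fv A"]) (simp_all add: Exists.prems)
  then show ?case by simp
qed simp_all

lemma subst_tm_comp: "subst_tm s (subst_tm s' t) = subst_tm (\<lambda>n. subst_tm s (s' n)) t"
  by (induction t) auto

lemma lift_subst_comp:
  "(\<lambda>n. subst_tm (lift_subst s) (lift_subst s' n)) = lift_subst (\<lambda>n. subst_tm s (s' n))"
  by (rule ext) (auto simp: lift_subst_def subst_tm_comp split: nat.split)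

lemma subst_fm_comp: "subst_fm s (subst_fm s' A) = subst_fm (\<lambda>n. subst_tm s (s' n)) A"
  by (induction A arbitrary: s s') (auto simp: lift_subst_comp subst_tm_comp)

lemma subst_tm_Var: "subst_tm Var t = t"
  by (induction t) (auto simp: map_idI)

lemma lift_subst_Var: "lift_subst Var = Var"
  by (rule ext) (auto simp: lift_subst_def split: nat.split)

lemma subst_fm_Var: "subst_fm Var A = A"
  by (induction A) (auto simp: lift_subst_Var subst_tm_Var map_idI)

lemma fv_subst_tm: "fv_tm (subst_tm s t) = (\<Union>n\<in>fv_tm t. fv_tm (s n))"
  by (induction t) auto

lemma fv_lift_subst: "{n. Suc n \<in> (\<Union>m\<in>M. fv_tm (lift_subst s m))} = (\<Union>m\<in>{m. Suc m \<in> M}. fv_tm (s m))"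
proof (intro set_eqI iffI)
  fix n assume "n \<in> {n. Suc n \<in> (\<Union>m\<in>M. fv_tm (lift_subst s m))}"
  then obtain m where m: "m \<in> M" "Suc n \<in> fv_tm (lift_subst s m)" by auto
  then show "n \<in> (\<Union>m\<in>{m. Suc m \<in> M}. fv_tm (s m))"
    by (cases m) (auto simp: lift_subst_def fv_subst_tm)
next
  fix n assume "n \<in> (\<Union>m\<in>{m. Suc m \<in> M}. fv_tm (s m))"
  then obtain m where "Suc m \<in> M" "n \<in> fv_tm (s m)" by auto
  then show "n \<in> {n. Suc n \<in> (\<Union>m\<in>M. fv_tm (lift_subst s m))}"
    by (auto simp: lift_subst_def fv_subst_tm intro!: bexI[of _ "Suc m"])
qed

lemma fv_subst_fm: "fv (subst_fm s A) = (\<Union>n\<in>fv A. fv_tm (s n))"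
  by (induction A arbitrary: s) (simp_all add: fv_subst_tm fv_lift_subst[simplified] UN_Un)

lemma fv_all: "fv (all x A) = fv A - {x}"
  by (auto simp: all_def bind_def fv_subst_fm split: if_splits)

lemma fv_ex: "fv (ex x A) = fv A - {x}"
  by (auto simp: ex_def bind_def fv_subst_fm split: if_splits)

lemma bind_alpha: "y \<notin> fv A \<Longrightarrow> bind y (inst (Var y) x A) = bind x A"
  by (auto simp: bind_def inst_def subst_fm_comp intro!: subst_fm_cong)

lemma all_alpha: "y \<notin> fv A \<Longrightarrow> all y (inst (Var y) x A) = all x A"
  by (simp add: all_def bind_alpha)

lemma ex_alpha: "y \<notin> fv A \<Longrightarrow> ex y (inst (Var y) x A) = ex x A"
  by (simp add: ex_def bind_alpha)

lemma inst_bind: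
  assumes "y \<noteq> x" "y \<notin> fv_tm t"
  shows "subst_fm (lift_subst (Var(x := t))) (bind y A) = bind y (inst t x A)"
  unfolding bind_def inst_def subst_fm_comp
  using assms by (intro subst_fm_cong) (auto simp: lift_subst_def intro!: subst_tm_cong)

lemma inst_all: "y \<noteq> x \<Longrightarrow> y \<notin> fv_tm t \<Longrightarrow> inst t x (all y A) = all y (inst t x A)"
  using inst_bind[of y x t A] by (simp add: all_def inst_def)

lemma inst_ex: "y \<noteq> x \<Longrightarrow> y \<notin> fv_tm t \<Longrightarrow> inst t x (ex y A) = ex y (inst t x A)"
  using inst_bind[of y x t A] by (simp add: ex_def inst_def)

lemma bind_surj:
  assumes "Suc x \<notin> fv B"
  shows "B = bind x (subst_fm (\<lambda>n. case n of 0 \<Rightarrow> Var x | Suc m \<Rightarrow> Var m) B)"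
proof -
  have "bind x (subst_fm (\<lambda>n. case n of 0 \<Rightarrow> Var x | Suc m \<Rightarrow> Var m) B) = subst_fm Var B"
    unfolding bind_def subst_fm_comp
    using assms by (intro subst_fm_cong) (auto split: nat.split)
  then show ?thesis by (simp add: subst_fm_Var)
qed

lemma Forall_is_all: "x \<notin> fv (Forall B) \<Longrightarrow> \<exists>A. Forall B = all x A"
  using bind_surj[of x B] by (auto simp: all_def)

lemma Exists_is_ex: "x \<notin> fv (Exists B) \<Longrightarrow> \<exists>A. Exists B = ex x A"
  using bind_surj[of x B] by (auto simp: ex_def)

text \<open>
  The terms instantiating quantifiers are those of the language with function symbols \<open>F\<close>.
  All other propositions in the premises of a rule are obtained from subformulas of its
  conclusion, so a derivation of a well-formed sequent consists of well-formed sequents.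
\<close>

inductive derivK :: "('f \<times> nat) set \<Rightarrow> ('f, 'p) fm multiset \<Rightarrow> ('f, 'p) fm \<Rightarrow> bool"
  for F :: "('f \<times> nat) set" where
  K_axiom: "derivK F (add_mset (Atom p ts) \<Gamma>) (Atom p ts)"
| K_TopR: "derivK F \<Gamma> Top"
| K_BotL: "derivK F (add_mset Bot \<Gamma>) G"
| K_ConjL: "derivK F (add_mset A (add_mset B \<Gamma>)) G \<Longrightarrow> derivK F (add_mset (A \<^bold>\<and> B) \<Gamma>) G"
| K_ConjR: "derivK F \<Gamma> A \<Longrightarrow> derivK F \<Gamma> B \<Longrightarrow> derivK F \<Gamma> (A \<^bold>\<and> B)"
| K_DisjL: "derivK F (add_mset A \<Gamma>) G \<Longrightarrow> derivK F (add_mset B \<Gamma>) G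
    \<Longrightarrow> derivK F (add_mset (A \<^bold>\<or> B) \<Gamma>) G"
| K_DisjR1: "derivK F \<Gamma> A \<Longrightarrow> derivK F \<Gamma> (A \<^bold>\<or> B)"
| K_DisjR2: "derivK F \<Gamma> B \<Longrightarrow> derivK F \<Gamma> (A \<^bold>\<or> B)"
| K_ImpR: "derivK F (add_mset A \<Gamma>) B \<Longrightarrow> derivK F \<Gamma> (A \<^bold>\<Rightarrow> B)"
| K_AllR: "derivK F \<Gamma> A \<Longrightarrow> x \<notin> fv_ctx \<Gamma> \<Longrightarrow> derivK F \<Gamma> (all x A)"
| K_AllL: "derivK F (add_mset (all x A) (add_mset (inst t x A) \<Gamma>)) G \<Longrightarrow> wf_tm F t
    \<Longrightarrow> derivK F (add_mset (all x A) \<Gamma>) G"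
| K_ExL: "derivK F (add_mset A \<Gamma>) G \<Longrightarrow> x \<notin> fv_ctx \<Gamma> \<union> fv G
    \<Longrightarrow> derivK F (add_mset (ex x A) \<Gamma>) G"
| K_ExR: "derivK F \<Gamma> (inst t x A) \<Longrightarrow> wf_tm F t \<Longrightarrow> derivK F \<Gamma> (ex x A)"
| K_ImpL: "derivK F (add_mset (A \<^bold>\<Rightarrow> B) \<Gamma>) A \<Longrightarrow> derivK F (add_mset B \<Gamma>) G
    \<Longrightarrow> derivK F (add_mset (A \<^bold>\<Rightarrow> B) \<Gamma>) G"

inductive derivD :: "('f \<times> nat) set \<Rightarrow> ('f, 'p) fm multiset \<Rightarrow> ('f, 'p) fm \<Rightarrow> bool"
  for F :: "('f \<times> nat) set" where
  D_axiom: "derivD F (add_mset (Atom p ts) \<Gamma>) (Atom p ts)"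
| D_TopR: "derivD F \<Gamma> Top"
| D_BotL: "derivD F (add_mset Bot \<Gamma>) G"
| D_ConjL: "derivD F (add_mset A (add_mset B \<Gamma>)) G \<Longrightarrow> derivD F (add_mset (A \<^bold>\<and> B) \<Gamma>) G"
| D_ConjR: "derivD F \<Gamma> A \<Longrightarrow> derivD F \<Gamma> B \<Longrightarrow> derivD F \<Gamma> (A \<^bold>\<and> B)"
| D_DisjL: "derivD F (add_mset A \<Gamma>) G \<Longrightarrow> derivD F (add_mset B \<Gamma>) G
    \<Longrightarrow> derivD F (add_mset (A \<^bold>\<or> B) \<Gamma>) G"
| D_DisjR1: "derivD F \<Gamma> A \<Longrightarrow> derivD F \<Gamma> (A \<^bold>\<or> B)"
| D_DisjR2: "derivD F \<Gamma> B \<Longrightarrow> derivD F \<Gamma> (A \<^bold>\<or> B)"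
| D_ImpR: "derivD F (add_mset A \<Gamma>) B \<Longrightarrow> derivD F \<Gamma> (A \<^bold>\<Rightarrow> B)"
| D_AllR: "derivD F \<Gamma> A \<Longrightarrow> x \<notin> fv_ctx \<Gamma> \<Longrightarrow> derivD F \<Gamma> (all x A)"
| D_AllL: "derivD F (add_mset (all x A) (add_mset (inst t x A) \<Gamma>)) G \<Longrightarrow> wf_tm F t
    \<Longrightarrow> derivD F (add_mset (all x A) \<Gamma>) G"
| D_ExL: "derivD F (add_mset A \<Gamma>) G \<Longrightarrow> x \<notin> fv_ctx \<Gamma> \<union> fv G
    \<Longrightarrow> derivD F (add_mset (ex x A) \<Gamma>) G"
| D_ExR: "derivD F \<Gamma> (inst t x A) \<Longrightarrow> wf_tm F t \<Longrightarrow> derivD F \<Gamma> (ex x A)"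
| D_ImpL_axiom: "derivD F (add_mset (Atom p ts) (add_mset B \<Gamma>)) G
    \<Longrightarrow> derivD F (add_mset (Atom p ts) (add_mset (Atom p ts \<^bold>\<Rightarrow> B) \<Gamma>)) G"
| D_ImpL_Top: "derivD F (add_mset B \<Gamma>) G \<Longrightarrow> derivD F (add_mset (Top \<^bold>\<Rightarrow> B) \<Gamma>) G"
| D_ImpL_Conj: "derivD F (add_mset (C \<^bold>\<Rightarrow> B) \<Gamma>) C \<Longrightarrow> derivD F (add_mset (E \<^bold>\<Rightarrow> B) \<Gamma>) E
    \<Longrightarrow> derivD F (add_mset B \<Gamma>) G \<Longrightarrow> derivD F (add_mset ((C \<^bold>\<and> E) \<^bold>\<Rightarrow> B) \<Gamma>) G"
| D_ImpL_Disj1: "derivD F (add_mset (C \<^bold>\<Rightarrow> B) (add_mset (E \<^bold>\<Rightarrow> B) \<Gamma>)) C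
    \<Longrightarrow> derivD F (add_mset B \<Gamma>) G \<Longrightarrow> derivD F (add_mset ((C \<^bold>\<or> E) \<^bold>\<Rightarrow> B) \<Gamma>) G"
| D_ImpL_Disj2: "derivD F (add_mset (C \<^bold>\<Rightarrow> B) (add_mset (E \<^bold>\<Rightarrow> B) \<Gamma>)) E
    \<Longrightarrow> derivD F (add_mset B \<Gamma>) G \<Longrightarrow> derivD F (add_mset ((C \<^bold>\<or> E) \<^bold>\<Rightarrow> B) \<Gamma>) G"
| D_ImpL_Imp: "derivD F (add_mset (E \<^bold>\<Rightarrow> B) (add_mset C \<Gamma>)) E
    \<Longrightarrow> derivD F (add_mset B \<Gamma>) G \<Longrightarrow> derivD F (add_mset ((C \<^bold>\<Rightarrow> E) \<^bold>\<Rightarrow> B) \<Gamma>) G"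
| D_ImpL_All: "derivD F (add_mset (all x C \<^bold>\<Rightarrow> B) \<Gamma>) C \<Longrightarrow> derivD F (add_mset B \<Gamma>) G
    \<Longrightarrow> x \<notin> fv_ctx \<Gamma> \<union> fv B \<Longrightarrow> derivD F (add_mset (all x C \<^bold>\<Rightarrow> B) \<Gamma>) G"
| D_ImpL_Ex: "derivD F (add_mset (ex x C \<^bold>\<Rightarrow> B) \<Gamma>) (inst t x C) \<Longrightarrow> wf_tm F t
    \<Longrightarrow> derivD F (add_mset B \<Gamma>) G \<Longrightarrow> derivD F (add_mset (ex x C \<^bold>\<Rightarrow> B) \<Gamma>) G"

end

theory Submission
  imports Defs
begin

text \<open>
  Both calculi are compared through variants in which the eigenvariable premise of a quantifier
  rule is replaced by one premise for every term of the language. These prove the same sequents: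
  a derivation can be instantiated at its eigenvariable, and conversely the instance at a fresh
  variable is such a premise. The structural arguments then need no renaming.

  From \<open>\<D>\<close> to \<open>\<K>\<close>: cut is admissible in \<open>\<K>\<close>, and the left implication rules of \<open>\<D>\<close> are derivable
  in \<open>\<K>\<close> with cut.

  From \<open>\<K>\<close> to \<open>\<D>\<close>: contraction of \<open>A\<close> and admissibility in \<open>\<D>\<close> of contr-\<open>\<Rightarrow>\<close>-left with antecedent
  \<open>A\<close> are proved simultaneously by induction on the size of \<open>A\<close>. For the latter, the derivation of
  \<open>\<Gamma>, A \<Rightarrow> B \<turnstile> A\<close> is followed upwards through left rules until a right rule introduces \<open>A\<close>; there
  the matching left rule of \<open>\<D>\<close> applies once the hypothesis \<open>A \<Rightarrow> B\<close> is replaced by those which that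
  rule puts in its place, such as \<open>C \<Rightarrow> B\<close> for \<open>(C \<and> E) \<Rightarrow> B\<close>.
\<close>

section \<open>Instances of quantified formulas\<close>

primrec connectives :: "('f, 'p) fm \<Rightarrow> nat" where
  "connectives (Atom p ts) = 0"
| "connectives Top = 0"
| "connectives Bot = 0"
| "connectives (A \<^bold>\<and> B) = Suc (connectives A + connectives B)"
| "connectives (A \<^bold>\<or> B) = Suc (connectives A + connectives B)"
| "connectives (A \<^bold>\<Rightarrow> B) = Suc (connectives A + connectives B)"
| "connectives (Forall A) = Suc (connectives A)"
| "connectives (Exists A) = Suc (connectives A)"

definition instantiate :: "'f tm \<Rightarrow> ('f, 'p) fm \<Rightarrow> ('f, 'p) fm" where
  "instantiate t A = subst_fm (case_nat t Var) A"

lemma connectives_subst_fm: "connectives (subst_fm s A) = connectives A"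
  by (induction A arbitrary: s) auto

lemma connectives_instantiate [simp]: "connectives (instantiate t A) = connectives A"
  by (simp add: instantiate_def connectives_subst_fm)

lemma instantiate_neq_Exists: "instantiate t A \<noteq> Exists A"
  using connectives_instantiate[of t A] by (metis connectives.simps(8) n_not_Suc_n)

lemma instantiate_subst_bind:
  "instantiate t (subst_fm (lift_subst s) (bind x A)) = subst_fm (s(x := t)) A"
  unfolding instantiate_def bind_def subst_fm_comp
  by (rule subst_fm_cong) (auto simp: lift_subst_def subst_tm_comp subst_tm_Var)

lemma instantiate_bind: "instantiate t (bind x A) = inst t x A"
  using instantiate_subst_bind[of t Var x A] by (simp add: lift_subst_Var subst_fm_Var inst_def)

lemma inst_Var_same: "inst (Var x) x A = A"
  by (simp add: inst_def subst_fm_Var)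

lemma subst_fm_inst: "subst_fm s (inst t x A) = subst_fm (s(x := subst_tm s t)) A"
  unfolding inst_def subst_fm_comp by (rule subst_fm_cong) auto

lemma subst_fm_upd_fresh: "x \<notin> fv A \<Longrightarrow> subst_fm (s(x := t)) A = subst_fm s A"
  by (rule subst_fm_cong) auto

lemma subst_ctx_upd_fresh:
  "x \<notin> fv_ctx \<Gamma> \<Longrightarrow> image_mset (subst_fm (s(x := t))) \<Gamma> = image_mset (subst_fm s) \<Gamma>"
  by (rule image_mset_cong) (auto simp: fv_ctx_def intro: subst_fm_upd_fresh)

lemma wf_tm_subst_tm: "wf_tm F t \<Longrightarrow> \<forall>n. wf_tm F (s n) \<Longrightarrow> wf_tm F (subst_tm s t)"
  by (induction t) (auto simp: list_all_iff)

lemma finite_fv_tm: "finite (fv_tm t)"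
  by (induction t) auto

lemma finite_fv: "finite (fv A)"
proof (induction A)
  case (Forall A)
  then show ?case using finite_vimageI[of "fv A" Suc] by (simp add: vimage_def)
next
  case (Exists A)
  then show ?case using finite_vimageI[of "fv A" Suc] by (simp add: vimage_def)
qed (auto simp: finite_fv_tm)

lemma finite_fv_ctx: "finite (fv_ctx \<Gamma>)"
  by (simp add: fv_ctx_def finite_fv)

lemma fresh_bind:
  assumes "finite M"
  obtains x A where "B = bind x A" "x \<notin> M"
proof -
  obtain x where x: "x \<notin> M \<union> fv (Forall B)"
    using assms finite_fv[of "Forall B"] by (metis ex_new_if_finite finite_UnI infinite_UNIV_nat)
  then have "B = bind x (subst_fm (case_nat (Var x) Var) B)"
    by (intro bind_surj) simp
  with x that show thesis by simp
qed

section \<open>Rules of the calculi with infinitary quantifier premises\<close>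

datatype calculus = Calculus_K (\<open>\<K>\<close>) | Calculus_D (\<open>\<D>\<close>)

text \<open>
  Rules are given without their side context: a premise \<open>(\<Delta>, H)\<close> stands for \<open>\<Delta>, \<Gamma> \<turnstile> H\<close> if the
  conclusion is \<open>L, \<Gamma> \<turnstile> G\<close> with principal formulas \<open>L\<close> on the left. In \<open>left_rule F c L T S\<close> the
  premises in \<open>T\<close> have a succedent of their own; those in \<open>S\<close> keep \<open>G\<close>, and only \<open>\<Delta>\<close> is recorded.
\<close>

inductive right_rule :: "('f \<times> nat) set \<Rightarrow> ('f, 'p) fm \<Rightarrow>
    (('f, 'p) fm multiset \<times> ('f, 'p) fm) set \<Rightarrow> bool"
  for F where
  TopR: "right_rule F Top {}"
| ConjR: "right_rule F (A \<^bold>\<and> B) {({#}, A), ({#}, B)}"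
| DisjR1: "right_rule F (A \<^bold>\<or> B) {({#}, A)}"
| DisjR2: "right_rule F (A \<^bold>\<or> B) {({#}, B)}"
| ImpR: "right_rule F (A \<^bold>\<Rightarrow> B) {({#A#}, B)}"
| AllR: "right_rule F (Forall A) {({#}, instantiate t A) |t. wf_tm F t}"
| ExR: "wf_tm F t \<Longrightarrow> right_rule F (Exists A) {({#}, instantiate t A)}"

inductive left_rule :: "('f \<times> nat) set \<Rightarrow> calculus \<Rightarrow> ('f, 'p) fm multiset \<Rightarrow>
    (('f, 'p) fm multiset \<times> ('f, 'p) fm) set \<Rightarrow> ('f, 'p) fm multiset set \<Rightarrow> bool"
  for F where
  BotL: "left_rule F c {#Bot#} {} {}"
| ConjL: "left_rule F c {#A \<^bold>\<and> B#} {} {{#A, B#}}"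
| DisjL: "left_rule F c {#A \<^bold>\<or> B#} {} {{#A#}, {#B#}}"
| AllL: "wf_tm F t \<Longrightarrow> left_rule F c {#Forall A#} {} {{#Forall A, instantiate t A#}}"
| ExL: "left_rule F c {#Exists A#} {} {{#instantiate t A#} |t. wf_tm F t}"
| ImpL: "left_rule F \<K> {#A \<^bold>\<Rightarrow> B#} {({#A \<^bold>\<Rightarrow> B#}, A)} {{#B#}}"
| ImpL_axiom: "left_rule F \<D> {#Atom p ts, Atom p ts \<^bold>\<Rightarrow> B#} {} {{#Atom p ts, B#}}"
| ImpL_Top: "left_rule F \<D> {#Top \<^bold>\<Rightarrow> B#} {} {{#B#}}"
| ImpL_Conj: "left_rule F \<D> {#(C \<^bold>\<and> E) \<^bold>\<Rightarrow> B#} {({#C \<^bold>\<Rightarrow> B#}, C), ({#E \<^bold>\<Rightarrow> B#}, E)} {{#B#}}"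
| ImpL_Disj1: "left_rule F \<D> {#(C \<^bold>\<or> E) \<^bold>\<Rightarrow> B#} {({#C \<^bold>\<Rightarrow> B, E \<^bold>\<Rightarrow> B#}, C)} {{#B#}}"
| ImpL_Disj2: "left_rule F \<D> {#(C \<^bold>\<or> E) \<^bold>\<Rightarrow> B#} {({#C \<^bold>\<Rightarrow> B, E \<^bold>\<Rightarrow> B#}, E)} {{#B#}}"
| ImpL_Imp: "left_rule F \<D> {#(C \<^bold>\<Rightarrow> E) \<^bold>\<Rightarrow> B#} {({#E \<^bold>\<Rightarrow> B, C#}, E)} {{#B#}}"
| ImpL_All: "left_rule F \<D> {#Forall C \<^bold>\<Rightarrow> B#}
    {({#Forall C \<^bold>\<Rightarrow> B#}, instantiate t C) |t. wf_tm F t} {{#B#}}"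
| ImpL_Ex: "wf_tm F t \<Longrightarrow>
    left_rule F \<D> {#Exists C \<^bold>\<Rightarrow> B#} {({#Exists C \<^bold>\<Rightarrow> B#}, instantiate t C)} {{#B#}}"

lemma left_rule_imp_contexts:
  "left_rule F c L T S \<Longrightarrow> A \<^bold>\<Rightarrow> B \<in># L \<Longrightarrow> S = {add_mset B (L - {#A \<^bold>\<Rightarrow> B#})}"
  by (erule left_rule.cases) auto

lemma left_rule_K_imp:
  assumes "left_rule F \<K> L T S" "A \<^bold>\<Rightarrow> B \<in># L"
  shows "L = {#A \<^bold>\<Rightarrow> B#}" "T = {({#A \<^bold>\<Rightarrow> B#}, A)}" "S = {{#B#}}"
  using assms by (auto elim: left_rule.cases)

lemma left_rule_non_imp:
  "left_rule F c L T S \<Longrightarrow> \<nexists>A B. A \<^bold>\<Rightarrow> B \<in># L \<Longrightarrow> left_rule F c' L T S"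
  by (induction rule: left_rule.induct) (simp_all add: left_rule.intros(1-5))

section \<open>Instances of eigenvariable premises\<close>

locale common_rules =
  fixes F :: "('f \<times> nat) set" and derives :: "('f, 'p) fm multiset \<Rightarrow> ('f, 'p) fm \<Rightarrow> bool"
  assumes TopR: "derives \<Gamma> Top"
    and BotL: "derives (add_mset Bot \<Gamma>) G"
    and ConjL: "derives (add_mset A (add_mset B \<Gamma>)) G \<Longrightarrow> derives (add_mset (A \<^bold>\<and> B) \<Gamma>) G"
    and ConjR: "derives \<Gamma> A \<Longrightarrow> derives \<Gamma> B \<Longrightarrow> derives \<Gamma> (A \<^bold>\<and> B)"
    and DisjL: "derives (add_mset A \<Gamma>) G \<Longrightarrow> derives (add_mset B \<Gamma>) G \<Longrightarrow>
      derives (add_mset (A \<^bold>\<or> B) \<Gamma>) G"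
    and DisjR1: "derives \<Gamma> A \<Longrightarrow> derives \<Gamma> (A \<^bold>\<or> B)"
    and DisjR2: "derives \<Gamma> B \<Longrightarrow> derives \<Gamma> (A \<^bold>\<or> B)"
    and ImpR: "derives (add_mset A \<Gamma>) B \<Longrightarrow> derives \<Gamma> (A \<^bold>\<Rightarrow> B)"
    and AllR: "derives \<Gamma> A \<Longrightarrow> x \<notin> fv_ctx \<Gamma> \<Longrightarrow> derives \<Gamma> (all x A)"
    and AllL: "derives (add_mset (all x A) (add_mset (inst t x A) \<Gamma>)) G \<Longrightarrow> wf_tm F t \<Longrightarrow>
      derives (add_mset (all x A) \<Gamma>) G"
    and ExL: "derives (add_mset A \<Gamma>) G \<Longrightarrow> x \<notin> fv_ctx \<Gamma> \<union> fv G \<Longrightarrow> derives (add_mset (ex x A) \<Gamma>) G"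
    and ExR: "derives \<Gamma> (inst t x A) \<Longrightarrow> wf_tm F t \<Longrightarrow> derives \<Gamma> (ex x A)"
begin

lemma Forall_right:
  assumes "\<forall>t. wf_tm F t \<longrightarrow> derives \<Gamma> (instantiate t B)"
  shows "derives \<Gamma> (Forall B)"
proof -
  obtain x A where "B = bind x A" "x \<notin> fv_ctx \<Gamma>" by (rule fresh_bind[OF finite_fv_ctx])
  then show ?thesis using AllR[of \<Gamma> A x] assms[rule_format, of "Var x"]
    by (simp add: all_def instantiate_bind inst_Var_same)
qed

lemma Forall_left:
  assumes "derives (add_mset (Forall B) (add_mset (instantiate t B) \<Gamma>)) G" "wf_tm F t"
  shows "derives (add_mset (Forall B) \<Gamma>) G"
proof -
  obtain x A where "B = bind x A" by (rule fresh_bind[OF finite.emptyI])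
  then show ?thesis using AllL[of x A t \<Gamma> G] assms by (simp add: all_def instantiate_bind)
qed

lemma Exists_left:
  assumes "\<forall>t. wf_tm F t \<longrightarrow> derives (add_mset (instantiate t B) \<Gamma>) G"
  shows "derives (add_mset (Exists B) \<Gamma>) G"
proof -
  have "finite (fv_ctx \<Gamma> \<union> fv G)" by (simp add: finite_fv finite_fv_ctx)
  then obtain x A where "B = bind x A" "x \<notin> fv_ctx \<Gamma> \<union> fv G" by (rule fresh_bind)
  then show ?thesis using ExL[of A \<Gamma> G x] assms[rule_format, of "Var x"]
    by (simp add: ex_def instantiate_bind inst_Var_same)
qed

lemma Exists_right:
  assumes "derives \<Gamma> (instantiate t B)" "wf_tm F t"
  shows "derives \<Gamma> (Exists B)"
proof -
  obtain x A where "B = bind x A" by (rule fresh_bind[OF finite.emptyI])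
  then show ?thesis using ExR[of \<Gamma> t x A] assms by (simp add: ex_def instantiate_bind)
qed

lemma right_rule_admissible:
  assumes "right_rule F G P" "\<forall>(\<Delta>, H)\<in>P. derives (\<Delta> + \<Gamma>) H"
  shows "derives \<Gamma> G"
  using assms(1)
proof cases
  case (AllR A)
  have "\<forall>t. wf_tm F t \<longrightarrow> derives \<Gamma> (instantiate t A)" using assms(2) AllR by auto
  then show ?thesis unfolding AllR by (rule Forall_right)
next
  case (ExR t A)
  then show ?thesis using assms(2) Exists_right[of \<Gamma> t A] by simp
qed (use assms(2) in \<open>simp_all add: TopR ConjR DisjR1 DisjR2 ImpR\<close>)

lemma non_imp_left_rule_admissible:
  assumes "left_rule F c L T S" "\<nexists>A B. A \<^bold>\<Rightarrow> B \<in># L" "\<forall>\<Delta>\<in>S. derives (\<Delta> + \<Gamma>) G"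
  shows "derives (L + \<Gamma>) G"
  using assms(1)
proof cases
  case (AllL t A)
  then show ?thesis using assms(3) Forall_left[of A t \<Gamma> G] by simp
next
  case (ExL A)
  have "\<forall>t. wf_tm F t \<longrightarrow> derives (add_mset (instantiate t A) \<Gamma>) G" using assms(3) ExL by auto
  then show ?thesis using Exists_left ExL by simp
qed (use assms(2,3) in \<open>auto simp: BotL ConjL DisjL\<close>)

end

section \<open>Derivations\<close>

lemma add_mset_eq_union_notin:
  assumes "L + \<Gamma> = add_mset X \<Delta>" "X \<notin># L"
  obtains \<Theta> where "\<Gamma> = add_mset X \<Theta>" "\<Delta> = L + \<Theta>"
proof -
  have "X \<in># \<Gamma>" using assms by (metis union_iff union_single_eq_member)
  then obtain \<Theta> where "\<Gamma> = add_mset X \<Theta>" by (metis insert_DiffM)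
  then show thesis using assms that by simp
qed

lemma add_mset_eq_union_in: "L + \<Gamma> = add_mset X \<Delta> \<Longrightarrow> X \<in># L \<Longrightarrow> \<Delta> = L - {#X#} + \<Gamma>"
  by (metis add_mset_remove_trivial diff_union_single_conv union_commute)

context
  fixes F :: "('f \<times> nat) set"
begin

inductive inference :: "calculus \<Rightarrow> ('f, 'p) fm multiset \<Rightarrow> ('f, 'p) fm \<Rightarrow>
    (('f, 'p) fm multiset \<times> ('f, 'p) fm) set \<Rightarrow> bool" for c where
  axiom: "inference c {#Atom p ts#} (Atom p ts) {}"
| right: "right_rule F G P \<Longrightarrow> inference c {#} G P"
| left: "left_rule F c L T S \<Longrightarrow> inference c L G (T \<union> S \<times> {G})"

inductive deriv :: "calculus \<Rightarrow> ('f, 'p) fm multiset \<Rightarrow> ('f, 'p) fm \<Rightarrow> bool" for c where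
  infer: "inference c L G P \<Longrightarrow> \<forall>(\<Delta>, H)\<in>P. deriv c (\<Delta> + \<Gamma>) H \<Longrightarrow> deriv c (L + \<Gamma>) G"

abbreviation turnstile :: "('f, 'p) fm multiset \<Rightarrow> calculus \<Rightarrow> ('f, 'p) fm \<Rightarrow> bool"
    (\<open>(_/ \<turnstile>\<^bsub>_\<^esub>/ _)\<close> [50, 0, 50] 50) where
  "\<Gamma> \<turnstile>\<^bsub>c\<^esub> G \<equiv> deriv c \<Gamma> G"

lemma deriv_axiom: "Atom p ts \<in># \<Gamma> \<Longrightarrow> \<Gamma> \<turnstile>\<^bsub>c\<^esub> Atom p ts"
  using deriv.infer[OF inference.axiom] by (metis empty_iff insert_DiffM2 union_commute)

lemma deriv_right: "right_rule F G P \<Longrightarrow> \<forall>(\<Delta>, H)\<in>P. \<Delta> + \<Gamma> \<turnstile>\<^bsub>c\<^esub> H \<Longrightarrow> \<Gamma> \<turnstile>\<^bsub>c\<^esub> G"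
  using deriv.infer[OF inference.right, of G P c \<Gamma>] by simp

lemma deriv_left:
  assumes "left_rule F c L T S" "\<forall>(\<Delta>, H)\<in>T. \<Delta> + \<Gamma> \<turnstile>\<^bsub>c\<^esub> H" "\<forall>\<Delta>\<in>S. \<Delta> + \<Gamma> \<turnstile>\<^bsub>c\<^esub> G"
  shows "L + \<Gamma> \<turnstile>\<^bsub>c\<^esub> G"
  by (rule deriv.infer[OF inference.left[OF assms(1)]]) (use assms(2,3) in auto)

lemma deriv_TopR: "\<Gamma> \<turnstile>\<^bsub>c\<^esub> Top"
  by (rule deriv_right[OF TopR]) simp

lemma deriv_ConjR: "\<Gamma> \<turnstile>\<^bsub>c\<^esub> A \<Longrightarrow> \<Gamma> \<turnstile>\<^bsub>c\<^esub> B \<Longrightarrow> \<Gamma> \<turnstile>\<^bsub>c\<^esub> A \<^bold>\<and> B"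
  by (rule deriv_right[OF ConjR]) simp

lemma deriv_DisjR1: "\<Gamma> \<turnstile>\<^bsub>c\<^esub> A \<Longrightarrow> \<Gamma> \<turnstile>\<^bsub>c\<^esub> A \<^bold>\<or> B"
  by (rule deriv_right[OF DisjR1]) simp

lemma deriv_DisjR2: "\<Gamma> \<turnstile>\<^bsub>c\<^esub> B \<Longrightarrow> \<Gamma> \<turnstile>\<^bsub>c\<^esub> A \<^bold>\<or> B"
  by (rule deriv_right[OF DisjR2]) simp

lemma deriv_ImpR: "add_mset A \<Gamma> \<turnstile>\<^bsub>c\<^esub> B \<Longrightarrow> \<Gamma> \<turnstile>\<^bsub>c\<^esub> A \<^bold>\<Rightarrow> B"
  by (rule deriv_right[OF ImpR]) simp

lemma deriv_AllR: "\<forall>t. wf_tm F t \<longrightarrow> \<Gamma> \<turnstile>\<^bsub>c\<^esub> instantiate t A \<Longrightarrow> \<Gamma> \<turnstile>\<^bsub>c\<^esub> Forall A"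
  by (rule deriv_right[OF AllR]) auto

lemma deriv_ExR: "\<Gamma> \<turnstile>\<^bsub>c\<^esub> instantiate t A \<Longrightarrow> wf_tm F t \<Longrightarrow> \<Gamma> \<turnstile>\<^bsub>c\<^esub> Exists A"
  by (rule deriv_right[OF ExR]) auto

lemma deriv_BotL: "add_mset Bot \<Gamma> \<turnstile>\<^bsub>c\<^esub> G"
  using deriv_left[OF BotL, where \<Gamma> = \<Gamma>] by simp

lemma deriv_ConjL: "add_mset A (add_mset B \<Gamma>) \<turnstile>\<^bsub>c\<^esub> G \<Longrightarrow> add_mset (A \<^bold>\<and> B) \<Gamma> \<turnstile>\<^bsub>c\<^esub> G"
  using deriv_left[OF ConjL, where \<Gamma> = \<Gamma>] by simp

lemma deriv_DisjL:
  "add_mset A \<Gamma> \<turnstile>\<^bsub>c\<^esub> G \<Longrightarrow> add_mset B \<Gamma> \<turnstile>\<^bsub>c\<^esub> G \<Longrightarrow> add_mset (A \<^bold>\<or> B) \<Gamma> \<turnstile>\<^bsub>c\<^esub> G"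
  using deriv_left[OF DisjL, where \<Gamma> = \<Gamma>] by simp

lemma deriv_AllL:
  "add_mset (Forall A) (add_mset (instantiate t A) \<Gamma>) \<turnstile>\<^bsub>c\<^esub> G \<Longrightarrow> wf_tm F t \<Longrightarrow>
    add_mset (Forall A) \<Gamma> \<turnstile>\<^bsub>c\<^esub> G"
  using deriv_left[OF AllL, where \<Gamma> = \<Gamma>] by simp

lemma deriv_ExL:
  assumes "\<forall>t. wf_tm F t \<longrightarrow> add_mset (instantiate t A) \<Gamma> \<turnstile>\<^bsub>c\<^esub> G"
  shows "add_mset (Exists A) \<Gamma> \<turnstile>\<^bsub>c\<^esub> G"
proof -
  have "{#Exists A#} + \<Gamma> \<turnstile>\<^bsub>c\<^esub> G" by (rule deriv_left[OF ExL]) (use assms in auto)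
  then show ?thesis by simp
qed

lemma deriv_K_ImpL:
  "add_mset (A \<^bold>\<Rightarrow> B) \<Gamma> \<turnstile>\<^bsub>\<K>\<^esub> A \<Longrightarrow> add_mset B \<Gamma> \<turnstile>\<^bsub>\<K>\<^esub> G \<Longrightarrow> add_mset (A \<^bold>\<Rightarrow> B) \<Gamma> \<turnstile>\<^bsub>\<K>\<^esub> G"
  using deriv_left[OF ImpL, where \<Gamma> = \<Gamma>] by simp

lemma deriv_D_ImpL_axiom:
  "add_mset (Atom p ts) (add_mset B \<Gamma>) \<turnstile>\<^bsub>\<D>\<^esub> G \<Longrightarrow>
    add_mset (Atom p ts) (add_mset (Atom p ts \<^bold>\<Rightarrow> B) \<Gamma>) \<turnstile>\<^bsub>\<D>\<^esub> G"
  using deriv_left[OF ImpL_axiom, where \<Gamma> = \<Gamma>] by simp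

lemma deriv_D_ImpL_Top: "add_mset B \<Gamma> \<turnstile>\<^bsub>\<D>\<^esub> G \<Longrightarrow> add_mset (Top \<^bold>\<Rightarrow> B) \<Gamma> \<turnstile>\<^bsub>\<D>\<^esub> G"
  using deriv_left[OF ImpL_Top, where \<Gamma> = \<Gamma>] by simp

lemma deriv_D_ImpL_Conj:
  "add_mset (C \<^bold>\<Rightarrow> B) \<Gamma> \<turnstile>\<^bsub>\<D>\<^esub> C \<Longrightarrow> add_mset (E \<^bold>\<Rightarrow> B) \<Gamma> \<turnstile>\<^bsub>\<D>\<^esub> E \<Longrightarrow> add_mset B \<Gamma> \<turnstile>\<^bsub>\<D>\<^esub> G \<Longrightarrow>
    add_mset ((C \<^bold>\<and> E) \<^bold>\<Rightarrow> B) \<Gamma> \<turnstile>\<^bsub>\<D>\<^esub> G"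
  using deriv_left[OF ImpL_Conj, where \<Gamma> = \<Gamma>] by simp

lemma deriv_D_ImpL_Disj1:
  "add_mset (C \<^bold>\<Rightarrow> B) (add_mset (E \<^bold>\<Rightarrow> B) \<Gamma>) \<turnstile>\<^bsub>\<D>\<^esub> C \<Longrightarrow> add_mset B \<Gamma> \<turnstile>\<^bsub>\<D>\<^esub> G \<Longrightarrow>
    add_mset ((C \<^bold>\<or> E) \<^bold>\<Rightarrow> B) \<Gamma> \<turnstile>\<^bsub>\<D>\<^esub> G"
  using deriv_left[OF ImpL_Disj1, where \<Gamma> = \<Gamma>] by simp

lemma deriv_D_ImpL_Disj2:
  "add_mset (C \<^bold>\<Rightarrow> B) (add_mset (E \<^bold>\<Rightarrow> B) \<Gamma>) \<turnstile>\<^bsub>\<D>\<^esub> E \<Longrightarrow> add_mset B \<Gamma> \<turnstile>\<^bsub>\<D>\<^esub> G \<Longrightarrow>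
    add_mset ((C \<^bold>\<or> E) \<^bold>\<Rightarrow> B) \<Gamma> \<turnstile>\<^bsub>\<D>\<^esub> G"
  using deriv_left[OF ImpL_Disj2, where \<Gamma> = \<Gamma>] by simp

lemma deriv_D_ImpL_Imp:
  "add_mset (E \<^bold>\<Rightarrow> B) (add_mset C \<Gamma>) \<turnstile>\<^bsub>\<D>\<^esub> E \<Longrightarrow> add_mset B \<Gamma> \<turnstile>\<^bsub>\<D>\<^esub> G \<Longrightarrow>
    add_mset ((C \<^bold>\<Rightarrow> E) \<^bold>\<Rightarrow> B) \<Gamma> \<turnstile>\<^bsub>\<D>\<^esub> G"
  using deriv_left[OF ImpL_Imp, where \<Gamma> = \<Gamma>] by simp

lemma deriv_D_ImpL_All:
  assumes "\<forall>t. wf_tm F t \<longrightarrow> add_mset (Forall C \<^bold>\<Rightarrow> B) \<Gamma> \<turnstile>\<^bsub>\<D>\<^esub> instantiate t C"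
    and "add_mset B \<Gamma> \<turnstile>\<^bsub>\<D>\<^esub> G"
  shows "add_mset (Forall C \<^bold>\<Rightarrow> B) \<Gamma> \<turnstile>\<^bsub>\<D>\<^esub> G"
proof -
  have "{#Forall C \<^bold>\<Rightarrow> B#} + \<Gamma> \<turnstile>\<^bsub>\<D>\<^esub> G" by (rule deriv_left[OF ImpL_All]) (use assms in auto)
  then show ?thesis by simp
qed

lemma deriv_D_ImpL_Ex:
  "add_mset (Exists C \<^bold>\<Rightarrow> B) \<Gamma> \<turnstile>\<^bsub>\<D>\<^esub> instantiate t C \<Longrightarrow> wf_tm F t \<Longrightarrow> add_mset B \<Gamma> \<turnstile>\<^bsub>\<D>\<^esub> G \<Longrightarrow>
    add_mset (Exists C \<^bold>\<Rightarrow> B) \<Gamma> \<turnstile>\<^bsub>\<D>\<^esub> G"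
  using deriv_left[OF ImpL_Ex, where \<Gamma> = \<Gamma>] by simp

section \<open>Weakening and inversion\<close>

lemma weakening: "\<Gamma> \<turnstile>\<^bsub>c\<^esub> G \<Longrightarrow> \<Gamma> \<subseteq># \<Gamma>' \<Longrightarrow> \<Gamma>' \<turnstile>\<^bsub>c\<^esub> G"
proof (induction arbitrary: \<Gamma>' rule: deriv.induct)
  case (infer L G P \<Gamma>)
  from infer.prems obtain \<Theta> where "\<Gamma>' = L + (\<Gamma> + \<Theta>)"
    by (metis add.assoc subset_mset.le_iff_add)
  moreover have "\<forall>(\<Delta>, H)\<in>P. \<Delta> + (\<Gamma> + \<Theta>) \<turnstile>\<^bsub>c\<^esub> H"
    using infer.IH by (auto simp: add.assoc[symmetric])
  ultimately show ?case using deriv.infer[OF infer.hyps] by blast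
qed

lemma deriv_replace:
  assumes "add_mset X \<Gamma> \<turnstile>\<^bsub>c\<^esub> G"
    and principal: "\<And>L G P \<Gamma>. inference c L G P \<Longrightarrow> X \<in># L \<Longrightarrow> \<forall>(\<Delta>, H)\<in>P. \<Delta> + \<Gamma> \<turnstile>\<^bsub>c\<^esub> H \<Longrightarrow>
      L - {#X#} + \<Theta> + \<Gamma> \<turnstile>\<^bsub>c\<^esub> G"
  shows "\<Theta> + \<Gamma> \<turnstile>\<^bsub>c\<^esub> G"
  using assms(1)
proof (induction "add_mset X \<Gamma>" G arbitrary: \<Gamma> rule: deriv.induct)
  case (infer L G P \<Gamma>')
  show ?case
  proof (cases "X \<in># L")
    case True
    have "L - {#X#} + \<Theta> + \<Gamma>' \<turnstile>\<^bsub>c\<^esub> G"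
      using principal[OF infer.hyps(1) True] infer.hyps(2) by blast
    then show ?thesis using add_mset_eq_union_in[OF infer.hyps(3) True] by (simp add: ac_simps)
  next
    case False
    with infer.hyps(3) obtain \<Xi> where \<Xi>: "\<Gamma>' = add_mset X \<Xi>" "\<Gamma> = L + \<Xi>"
      by (rule add_mset_eq_union_notin)
    have "\<Delta> + (\<Theta> + \<Xi>) \<turnstile>\<^bsub>c\<^esub> H" if "(\<Delta>, H) \<in> P" for \<Delta> H
      using infer.hyps(2) that \<Xi>(1) by (auto simp: ac_simps)
    then have "L + (\<Theta> + \<Xi>) \<turnstile>\<^bsub>c\<^esub> G" by (intro deriv.infer[OF infer.hyps(1)]) auto
    then show ?thesis using \<Xi>(2) by (simp add: ac_simps)
  qed
qed

lemma deriv_invert: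
  assumes "add_mset X \<Gamma> \<turnstile>\<^bsub>c\<^esub> G"
    and "\<And>L G P. inference c L G P \<Longrightarrow> X \<in># L \<Longrightarrow> (L - {#X#} + \<Theta>, G) \<in> P"
  shows "\<Theta> + \<Gamma> \<turnstile>\<^bsub>c\<^esub> G"
  using assms(1) by (rule deriv_replace) (use assms(2) in blast)

lemma ImpL_inversion: "add_mset (A \<^bold>\<Rightarrow> B) \<Gamma> \<turnstile>\<^bsub>c\<^esub> G \<Longrightarrow> {#B#} + \<Gamma> \<turnstile>\<^bsub>c\<^esub> G"
  by (erule deriv_invert) (auto elim!: inference.cases left_rule.cases)

lemma left_rule_inversion:
  assumes "left_rule F c L T S" "\<Delta> \<in> S" "L + \<Gamma> \<turnstile>\<^bsub>c\<^esub> G"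
  shows "\<Delta> + \<Gamma> \<turnstile>\<^bsub>c\<^esub> G"
  using assms(1)
proof (cases rule: left_rule.cases)
  case (ConjL A B)
  have "{#A, B#} + \<Gamma> \<turnstile>\<^bsub>c\<^esub> G"
    by (rule deriv_invert[where X = "A \<^bold>\<and> B"])
      (use assms ConjL in \<open>auto elim!: inference.cases left_rule.cases\<close>)
  then show ?thesis using assms(2) ConjL by simp
next
  case (DisjL A B)
  have "{#C#} + \<Gamma> \<turnstile>\<^bsub>c\<^esub> G" if "C = A \<or> C = B" for C
    by (rule deriv_invert[where X = "A \<^bold>\<or> B"])
      (use assms DisjL that in \<open>auto elim!: inference.cases left_rule.cases\<close>)
  then show ?thesis using assms(2) DisjL by auto
next
  case (AllL t A)
  then show ?thesis using assms by (auto intro: weakening)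
next
  case (ExL A)
  have "{#instantiate t A#} + \<Gamma> \<turnstile>\<^bsub>c\<^esub> G" if "wf_tm F t" for t
    by (rule deriv_invert[where X = "Exists A"])
      (use assms ExL that in \<open>auto elim!: inference.cases left_rule.cases\<close>)
  then show ?thesis using assms(2) ExL by auto
next
  case (ImpL_axiom p ts B)
  then show ?thesis using assms(2,3) ImpL_inversion[where \<Gamma> = "add_mset (Atom p ts) \<Gamma>"]
    by (simp add: add_mset_commute)
qed (use assms(2,3) ImpL_inversion in auto)

lemma deriv_rules_induct [consumes 1, case_names axiom right left]:
  assumes "\<Gamma> \<turnstile>\<^bsub>c\<^esub> G"
    and "\<And>p ts \<Gamma>. Q (add_mset (Atom p ts) \<Gamma>) (Atom p ts)"
    and "\<And>G P \<Gamma>. right_rule F G P \<Longrightarrow> \<forall>(\<Delta>, H)\<in>P. Q (\<Delta> + \<Gamma>) H \<Longrightarrow> Q \<Gamma> G"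
    and "\<And>L T S \<Gamma> G. left_rule F c L T S \<Longrightarrow> \<forall>(\<Delta>, H)\<in>T. Q (\<Delta> + \<Gamma>) H \<Longrightarrow> \<forall>\<Delta>\<in>S. Q (\<Delta> + \<Gamma>) G \<Longrightarrow>
      Q (L + \<Gamma>) G"
  shows "Q \<Gamma> G"
  using assms(1)
proof (induction rule: deriv.induct)
  case (infer L G P \<Gamma>)
  from infer.hyps show ?case
  proof cases
    case (axiom p ts)
    then show ?thesis using assms(2) by simp
  next
    case right
    then show ?thesis using assms(3)[of G P \<Gamma>] infer.IH by auto
  next
    case (left T S)
    then show ?thesis using assms(4)[of L T S \<Gamma> G] infer.IH by auto
  qed
qed

text \<open>
  A derivation of \<open>A\<close> is followed upwards through the premises of left rules that keep \<open>A\<close> as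
  succedent, until \<open>A\<close> is introduced.
\<close>

lemma deriv_reduce_to_introduction:
  assumes "\<Gamma> \<turnstile>\<^bsub>c\<^esub> A" "R \<Gamma>"
    and "\<And>L T S \<Delta> \<Gamma>. left_rule F c L T S \<Longrightarrow> \<Delta> \<in> S \<Longrightarrow> R (L + \<Gamma>) \<Longrightarrow> R (\<Delta> + \<Gamma>)"
    and "\<And>p ts \<Gamma>. A = Atom p ts \<Longrightarrow> R (add_mset A \<Gamma>) \<Longrightarrow> add_mset A \<Gamma> \<turnstile>\<^bsub>c\<^esub> G"
    and "\<And>P \<Gamma>. right_rule F A P \<Longrightarrow> \<forall>(\<Delta>, H)\<in>P. \<Delta> + \<Gamma> \<turnstile>\<^bsub>c\<^esub> H \<Longrightarrow> R \<Gamma> \<Longrightarrow> \<Gamma> \<turnstile>\<^bsub>c\<^esub> G"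
  shows "\<Gamma> \<turnstile>\<^bsub>c\<^esub> G"
proof -
  have "H = A \<longrightarrow> R \<Gamma> \<longrightarrow> \<Gamma> \<turnstile>\<^bsub>c\<^esub> G" if "\<Gamma> \<turnstile>\<^bsub>c\<^esub> H" for \<Gamma> H
    using that
  proof (induction rule: deriv.induct)
    case (infer L H P \<Gamma>)
    have premises_derivable: "\<forall>(\<Delta>, K)\<in>P. \<Delta> + \<Gamma> \<turnstile>\<^bsub>c\<^esub> K" using infer.IH by auto
    show ?case
    proof (intro impI)
      assume "H = A" and R: "R (L + \<Gamma>)"
      from infer.hyps show "L + \<Gamma> \<turnstile>\<^bsub>c\<^esub> G"
      proof cases
        case (axiom p ts)
        then show ?thesis using assms(4) \<open>H = A\<close> R by simp
      next
        case right
        then show ?thesis using assms(5) premises_derivable \<open>H = A\<close> R by simp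
      next
        case (left T S)
        have "\<Delta> + \<Gamma> \<turnstile>\<^bsub>c\<^esub> G" if "\<Delta> \<in> S" for \<Delta>
          using infer.IH assms(3)[OF left(2) that R] left(1) that \<open>H = A\<close> by auto
        then show ?thesis using deriv_left[OF left(2)] premises_derivable left(1) by auto
      qed
    qed
  qed
  then show ?thesis using assms(1,2) by blast
qed

section \<open>Cut elimination in \<open>\<K>\<close> and the rules of \<open>\<D>\<close>\<close>

lemma K_premise_inversion:
  assumes "inference \<K> L G P" "(\<Delta>, H) \<in> P" "L + \<Gamma> \<turnstile>\<^bsub>\<K>\<^esub> A"
  shows "\<Delta> + \<Gamma> \<turnstile>\<^bsub>\<K>\<^esub> A"
  using assms(1)
proof cases
  case (left T S)
  then consider (own) "(\<Delta>, H) \<in> T" | (kept) "\<Delta> \<in> S" using assms(2) by auto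
  then show ?thesis
  proof cases
    case own
    with left(2) have "\<Delta> = L" by (auto elim: left_rule.cases)
    then show ?thesis using assms(3) by simp
  next
    case kept
    with left(2) show ?thesis using assms(3) by (rule left_rule_inversion)
  qed
qed (use assms(2,3) in \<open>auto intro: weakening\<close>)

lemma K_principal_singleton: "inference \<K> L G P \<Longrightarrow> A \<in># L \<Longrightarrow> L = {#A#}"
  by (auto elim!: inference.cases left_rule.cases)

definition cut_admissible :: "('f, 'p) fm \<Rightarrow> bool" where
  "cut_admissible A \<longleftrightarrow> (\<forall>\<Gamma> G. \<Gamma> \<turnstile>\<^bsub>\<K>\<^esub> A \<longrightarrow> add_mset A \<Gamma> \<turnstile>\<^bsub>\<K>\<^esub> G \<longrightarrow> \<Gamma> \<turnstile>\<^bsub>\<K>\<^esub> G)"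

lemma cut_admissibleD: "cut_admissible A \<Longrightarrow> \<Gamma> \<turnstile>\<^bsub>\<K>\<^esub> A \<Longrightarrow> add_mset A \<Gamma> \<turnstile>\<^bsub>\<K>\<^esub> G \<Longrightarrow> \<Gamma> \<turnstile>\<^bsub>\<K>\<^esub> G"
  by (auto simp: cut_admissible_def)

text \<open>
  The rules \<open>\<forall>\<close>-left and contr-\<open>\<Rightarrow>\<close>-left keep their principal formula \<open>A\<close> in a premise;
  \<open>\<Delta> - {#A#}\<close> is what remains once that copy has been cut.
\<close>

lemma cut_principal:
  fixes A :: "('f, 'p) fm"
  assumes smaller: "\<And>B :: ('f, 'p) fm. connectives B < connectives A \<Longrightarrow> cut_admissible B"
    and right: "right_rule F A P" "\<forall>(\<Delta>, H)\<in>P. \<Delta> + \<Gamma> \<turnstile>\<^bsub>\<K>\<^esub> H"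
    and left: "left_rule F \<K> {#A#} T S" "\<forall>(\<Delta>, H)\<in>T \<union> S \<times> {G}. \<Delta> - {#A#} + \<Gamma> \<turnstile>\<^bsub>\<K>\<^esub> H"
  shows "\<Gamma> \<turnstile>\<^bsub>\<K>\<^esub> G"
proof -
  note cut = cut_admissibleD[OF smaller]
  from right(1) show ?thesis
  proof cases
    case TopR
    then show ?thesis using left(1) by (auto elim: left_rule.cases)
  next
    case (ConjR B C)
    have "S = {{#B, C#}}" using left(1) ConjR by (auto elim: left_rule.cases)
    then have "add_mset B (add_mset C \<Gamma>) \<turnstile>\<^bsub>\<K>\<^esub> G" using left(2) ConjR by simp
    moreover have "\<Gamma> \<turnstile>\<^bsub>\<K>\<^esub> C" "add_mset C \<Gamma> \<turnstile>\<^bsub>\<K>\<^esub> B" using right(2) ConjR by (auto intro: weakening)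
    ultimately show ?thesis using cut[of B "add_mset C \<Gamma>" G] cut[of C \<Gamma> G] ConjR by simp
  next
    case (DisjR1 B C)
    have "S = {{#B#}, {#C#}}" using left(1) DisjR1 by (auto elim: left_rule.cases)
    then show ?thesis using left(2) right(2) cut[of B \<Gamma> G] DisjR1 by simp
  next
    case (DisjR2 B C)
    have "S = {{#B#}, {#C#}}" using left(1) DisjR2 by (auto elim: left_rule.cases)
    then show ?thesis using left(2) right(2) cut[of C \<Gamma> G] DisjR2 by simp
  next
    case (ImpR B C)
    have "T = {({#B \<^bold>\<Rightarrow> C#}, B)}" "S = {{#C#}}"
      using left_rule_K_imp[OF left(1)] ImpR by simp_all
    then have "\<Gamma> \<turnstile>\<^bsub>\<K>\<^esub> B" "add_mset C \<Gamma> \<turnstile>\<^bsub>\<K>\<^esub> G" using left(2) ImpR by simp_all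
    moreover have "add_mset B \<Gamma> \<turnstile>\<^bsub>\<K>\<^esub> C" using right(2) ImpR by simp
    ultimately show ?thesis using cut[of B \<Gamma> C] cut[of C \<Gamma> G] ImpR by simp
  next
    case (AllR B)
    obtain t where "wf_tm F t" "S = {{#Forall B, instantiate t B#}}"
      using left(1) AllR by (auto elim: left_rule.cases)
    moreover from this have "add_mset (instantiate t B) \<Gamma> \<turnstile>\<^bsub>\<K>\<^esub> G" using left(2) AllR by simp
    ultimately show ?thesis using right(2) cut[of "instantiate t B" \<Gamma> G] AllR by auto
  next
    case (ExR t B)
    have "{#instantiate t B#} \<in> S" using left(1) ExR by (auto elim: left_rule.cases)
    then have "{#instantiate t B#} - {#A#} + \<Gamma> \<turnstile>\<^bsub>\<K>\<^esub> G" using left(2) by blast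
    then have "add_mset (instantiate t B) \<Gamma> \<turnstile>\<^bsub>\<K>\<^esub> G"
      using ExR by (simp add: instantiate_neq_Exists)
    then show ?thesis using right(2) cut[of "instantiate t B" \<Gamma> G] ExR by simp
  qed
qed

lemma cut_left_principal:
  fixes A :: "('f, 'p) fm"
  assumes smaller: "\<And>B :: ('f, 'p) fm. connectives B < connectives A \<Longrightarrow> cut_admissible B"
    and rule: "inference \<K> {#A#} G P" and "\<forall>(\<Delta>, H)\<in>P. \<Delta> - {#A#} + \<Gamma> \<turnstile>\<^bsub>\<K>\<^esub> H"
    and "\<Gamma> \<turnstile>\<^bsub>\<K>\<^esub> A"
  shows "\<Gamma> \<turnstile>\<^bsub>\<K>\<^esub> G"
  using rule
proof cases
  case (left T S)
  define reduced where "reduced \<Gamma> \<longleftrightarrow> (\<forall>(\<Delta>, H)\<in>T \<union> S \<times> {G}. \<Delta> - {#A#} + \<Gamma> \<turnstile>\<^bsub>\<K>\<^esub> H)" for \<Gamma>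
  have "reduced \<Gamma>" using assms(3) left(1) by (simp add: reduced_def)
  with assms(4) show ?thesis
  proof (rule deriv_reduce_to_introduction)
    show "reduced (\<Delta>' + \<Gamma>)" if "left_rule F \<K> L T' S'" "\<Delta>' \<in> S'" "reduced (L + \<Gamma>)" for L T' S' \<Delta>' \<Gamma>
    proof -
      have "\<Delta> - {#A#} + (\<Delta>' + \<Gamma>) \<turnstile>\<^bsub>\<K>\<^esub> H" if "(\<Delta>, H) \<in> T \<union> S \<times> {G}" for \<Delta> H
      proof -
        have "L + (\<Delta> - {#A#} + \<Gamma>) \<turnstile>\<^bsub>\<K>\<^esub> H"
          using \<open>reduced (L + \<Gamma>)\<close> that unfolding reduced_def
          by (metis (lifting) add.left_commute case_prodD)
        then have "\<Delta>' + (\<Delta> - {#A#} + \<Gamma>) \<turnstile>\<^bsub>\<K>\<^esub> H"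
          by (rule left_rule_inversion[OF \<open>left_rule F \<K> L T' S'\<close> \<open>\<Delta>' \<in> S'\<close>])
        then show ?thesis by (simp add: add.left_commute)
      qed
      then show ?thesis unfolding reduced_def by blast
    qed
    show "add_mset A \<Gamma> \<turnstile>\<^bsub>\<K>\<^esub> G" if "A = Atom p ts" for p ts \<Gamma>
      using left(2) that by (auto elim: left_rule.cases)
    show "\<Gamma> \<turnstile>\<^bsub>\<K>\<^esub> G" if "right_rule F A P" "\<forall>(\<Delta>, H)\<in>P. \<Delta> + \<Gamma> \<turnstile>\<^bsub>\<K>\<^esub> H" "reduced \<Gamma>" for P \<Gamma>
      using smaller that(1,2) left(2) that(3)[unfolded reduced_def] by (rule cut_principal)
  qed
qed (use assms(4) in simp_all)

lemma cut_admissible_step: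
  fixes A :: "('f, 'p) fm"
  assumes smaller: "\<And>B :: ('f, 'p) fm. connectives B < connectives A \<Longrightarrow> cut_admissible B"
  shows "cut_admissible A"
proof -
  have "\<Gamma> \<turnstile>\<^bsub>\<K>\<^esub> G" if "add_mset A \<Gamma> \<turnstile>\<^bsub>\<K>\<^esub> G" "\<Gamma> \<turnstile>\<^bsub>\<K>\<^esub> A" for \<Gamma> G
    using that
  proof (induction "add_mset A \<Gamma>" G arbitrary: \<Gamma> rule: deriv.induct)
    case (infer L G P \<Gamma>')
    have cut_premise: "\<Delta> \<turnstile>\<^bsub>\<K>\<^esub> H"
      if "(\<Xi>, H) \<in> P" "\<Xi> + \<Gamma>' = add_mset A \<Delta>" "\<Delta> \<turnstile>\<^bsub>\<K>\<^esub> A" for \<Xi> H \<Delta>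
      using infer.hyps(2) that by auto
    show ?case
    proof (cases "A \<in># L")
      case False
      with infer.hyps(3) obtain \<Xi> where \<Xi>: "\<Gamma>' = add_mset A \<Xi>" "\<Gamma> = L + \<Xi>"
        by (rule add_mset_eq_union_notin)
      have "\<Delta> + \<Xi> \<turnstile>\<^bsub>\<K>\<^esub> H" if "(\<Delta>, H) \<in> P" for \<Delta> H
        using cut_premise[OF that] K_premise_inversion[OF infer.hyps(1) that] infer.prems \<Xi>
        by simp
      then show ?thesis unfolding \<Xi>(2) by (intro deriv.infer[OF infer.hyps(1)]) auto
    next
      case True
      have L: "L = {#A#}" using infer.hyps(1) True by (rule K_principal_singleton)
      then have "\<Gamma>' = \<Gamma>" using infer.hyps(3) by simp
      have "\<Delta> - {#A#} + \<Gamma> \<turnstile>\<^bsub>\<K>\<^esub> H" if "(\<Delta>, H) \<in> P" for \<Delta> H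
      proof (cases "A \<in># \<Delta>")
        case True
        then have "\<Delta> + \<Gamma>' = add_mset A (\<Delta> - {#A#} + \<Gamma>)" using \<open>\<Gamma>' = \<Gamma>\<close> by simp
        moreover have "\<Delta> - {#A#} + \<Gamma> \<turnstile>\<^bsub>\<K>\<^esub> A" using infer.prems by (rule weakening) simp
        ultimately show ?thesis by (rule cut_premise[OF that])
      next
        case False
        then show ?thesis using infer.hyps(2) that \<open>\<Gamma>' = \<Gamma>\<close> by (auto simp: diff_single_trivial)
      qed
      then have "\<forall>(\<Delta>, H)\<in>P. \<Delta> - {#A#} + \<Gamma> \<turnstile>\<^bsub>\<K>\<^esub> H" by blast
      from smaller infer.hyps(1)[unfolded L] this infer.prems show ?thesis
        by (rule cut_left_principal)
    qed
  qed
  then show ?thesis by (simp add: cut_admissible_def)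
qed

theorem K_cut:
  assumes "\<Gamma> \<turnstile>\<^bsub>\<K>\<^esub> A" "add_mset A \<Gamma> \<turnstile>\<^bsub>\<K>\<^esub> G"
  shows "\<Gamma> \<turnstile>\<^bsub>\<K>\<^esub> G"
proof -
  have "cut_admissible A"
    by (induction A rule: measure_induct_rule[of connectives]) (rule cut_admissible_step)
  then show ?thesis using assms by (rule cut_admissibleD)
qed

lemma K_identity: "add_mset A \<Gamma> \<turnstile>\<^bsub>\<K>\<^esub> A"
proof (induction A arbitrary: \<Gamma> rule: measure_induct_rule[of connectives])
  case (less A)
  show ?case
  proof (cases A)
    case (Conj B C)
    have "add_mset B (add_mset C \<Gamma>) \<turnstile>\<^bsub>\<K>\<^esub> B" "add_mset B (add_mset C \<Gamma>) \<turnstile>\<^bsub>\<K>\<^esub> C"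
      using less[of B "add_mset C \<Gamma>"] less[of C "add_mset B \<Gamma>"] Conj
      by (simp_all add: add_mset_commute)
    then show ?thesis unfolding Conj by (rule deriv_ConjL[OF deriv_ConjR])
  next
    case (Disj B C)
    then show ?thesis using less by (simp add: deriv_DisjL deriv_DisjR1 deriv_DisjR2)
  next
    case (Imp B C)
    have "add_mset (B \<^bold>\<Rightarrow> C) (add_mset B \<Gamma>) \<turnstile>\<^bsub>\<K>\<^esub> B"
      using less[of B "add_mset (B \<^bold>\<Rightarrow> C) \<Gamma>"] Imp by (simp add: add_mset_commute)
    then have "add_mset (B \<^bold>\<Rightarrow> C) (add_mset B \<Gamma>) \<turnstile>\<^bsub>\<K>\<^esub> C"
      by (rule deriv_K_ImpL) (use less[of C] Imp in simp)
    then have "add_mset B (add_mset (B \<^bold>\<Rightarrow> C) \<Gamma>) \<turnstile>\<^bsub>\<K>\<^esub> C" by (simp add: add_mset_commute)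
    then show ?thesis unfolding Imp by (rule deriv_ImpR)
  next
    case (Forall B)
    have "add_mset (Forall B) \<Gamma> \<turnstile>\<^bsub>\<K>\<^esub> instantiate t B" if "wf_tm F t" for t
    proof (rule deriv_AllL)
      show "add_mset (Forall B) (add_mset (instantiate t B) \<Gamma>) \<turnstile>\<^bsub>\<K>\<^esub> instantiate t B"
        using less[of "instantiate t B" "add_mset (Forall B) \<Gamma>"] Forall
        by (simp add: add_mset_commute)
    qed (fact that)
    then show ?thesis unfolding Forall by (simp add: deriv_AllR)
  next
    case (Exists B)
    have "add_mset (instantiate t B) \<Gamma> \<turnstile>\<^bsub>\<K>\<^esub> Exists B" if "wf_tm F t" for t
    proof (rule deriv_ExR)
      show "add_mset (instantiate t B) \<Gamma> \<turnstile>\<^bsub>\<K>\<^esub> instantiate t B" using less Exists by simp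
    qed (fact that)
    then show ?thesis unfolding Exists by (simp add: deriv_ExL)
  qed (simp_all add: deriv_axiom deriv_TopR deriv_BotL)
qed

lemma K_modus_ponens:
  assumes "A \<^bold>\<Rightarrow> B \<in># \<Gamma>" "\<Gamma> \<turnstile>\<^bsub>\<K>\<^esub> A"
  shows "\<Gamma> \<turnstile>\<^bsub>\<K>\<^esub> B"
  using assms deriv_K_ImpL[OF _ K_identity] by (metis insert_DiffM)

lemma K_strengthen_antecedent:
  assumes "A \<^bold>\<Rightarrow> B \<in># \<Gamma>" "add_mset C \<Gamma> \<turnstile>\<^bsub>\<K>\<^esub> A" "add_mset (C \<^bold>\<Rightarrow> B) \<Gamma> \<turnstile>\<^bsub>\<K>\<^esub> G"
  shows "\<Gamma> \<turnstile>\<^bsub>\<K>\<^esub> G"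
proof (rule K_cut)
  show "\<Gamma> \<turnstile>\<^bsub>\<K>\<^esub> C \<^bold>\<Rightarrow> B"
    by (rule deriv_ImpR, rule K_modus_ponens[of A]) (use assms in auto)
qed (fact assms(3))

lemma K_ImpL_Conj_antecedent:
  assumes "add_mset (C \<^bold>\<Rightarrow> B) \<Gamma> \<turnstile>\<^bsub>\<K>\<^esub> C" "add_mset (E \<^bold>\<Rightarrow> B) \<Gamma> \<turnstile>\<^bsub>\<K>\<^esub> E"
  shows "add_mset ((C \<^bold>\<and> E) \<^bold>\<Rightarrow> B) \<Gamma> \<turnstile>\<^bsub>\<K>\<^esub> C \<^bold>\<and> E"
proof -
  define \<Xi> where "\<Xi> = add_mset ((C \<^bold>\<and> E) \<^bold>\<Rightarrow> B) \<Gamma>"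
  have E: "add_mset C \<Xi> \<turnstile>\<^bsub>\<K>\<^esub> E"
  proof (rule K_strengthen_antecedent)
    show "add_mset E (add_mset C \<Xi>) \<turnstile>\<^bsub>\<K>\<^esub> C \<^bold>\<and> E"
      by (metis K_identity add_mset_commute deriv_ConjR)
    show "add_mset (E \<^bold>\<Rightarrow> B) (add_mset C \<Xi>) \<turnstile>\<^bsub>\<K>\<^esub> E"
      using assms(2) by (rule weakening) (simp add: \<Xi>_def)
  qed (simp add: \<Xi>_def)
  have C: "\<Xi> \<turnstile>\<^bsub>\<K>\<^esub> C"
  proof (rule K_strengthen_antecedent)
    show "add_mset C \<Xi> \<turnstile>\<^bsub>\<K>\<^esub> C \<^bold>\<and> E" using K_identity E by (rule deriv_ConjR)
    show "add_mset (C \<^bold>\<Rightarrow> B) \<Xi> \<turnstile>\<^bsub>\<K>\<^esub> C" using assms(1) by (rule weakening) (simp add: \<Xi>_def)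
  qed (simp add: \<Xi>_def)
  then have "\<Xi> \<turnstile>\<^bsub>\<K>\<^esub> E" using E by (rule K_cut)
  with C show ?thesis unfolding \<Xi>_def by (rule deriv_ConjR)
qed

lemma K_ImpL_Disj_antecedent:
  assumes "add_mset (C \<^bold>\<Rightarrow> B) (add_mset (E \<^bold>\<Rightarrow> B) \<Gamma>) \<turnstile>\<^bsub>\<K>\<^esub> G"
  shows "add_mset ((C \<^bold>\<or> E) \<^bold>\<Rightarrow> B) \<Gamma> \<turnstile>\<^bsub>\<K>\<^esub> G"
proof -
  define \<Xi> where "\<Xi> = add_mset ((C \<^bold>\<or> E) \<^bold>\<Rightarrow> B) \<Gamma>"
  have "add_mset (E \<^bold>\<Rightarrow> B) \<Xi> \<turnstile>\<^bsub>\<K>\<^esub> G"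
  proof (rule K_strengthen_antecedent)
    show "add_mset C (add_mset (E \<^bold>\<Rightarrow> B) \<Xi>) \<turnstile>\<^bsub>\<K>\<^esub> C \<^bold>\<or> E" by (intro deriv_DisjR1 K_identity)
    show "add_mset (C \<^bold>\<Rightarrow> B) (add_mset (E \<^bold>\<Rightarrow> B) \<Xi>) \<turnstile>\<^bsub>\<K>\<^esub> G"
      using assms by (rule weakening) (simp add: \<Xi>_def)
  qed (simp add: \<Xi>_def)
  moreover have "add_mset E \<Xi> \<turnstile>\<^bsub>\<K>\<^esub> C \<^bold>\<or> E" by (intro deriv_DisjR2 K_identity)
  ultimately show ?thesis unfolding \<Xi>_def[symmetric]
    by (intro K_strengthen_antecedent[of "C \<^bold>\<or> E" B \<Xi> E G]) (simp_all add: \<Xi>_def)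
qed

lemma K_ImpL_Imp_antecedent:
  assumes "add_mset (E \<^bold>\<Rightarrow> B) (add_mset C \<Gamma>) \<turnstile>\<^bsub>\<K>\<^esub> E"
  shows "add_mset ((C \<^bold>\<Rightarrow> E) \<^bold>\<Rightarrow> B) \<Gamma> \<turnstile>\<^bsub>\<K>\<^esub> C \<^bold>\<Rightarrow> E"
proof (rule deriv_ImpR, rule K_strengthen_antecedent)
  let ?\<Xi> = "add_mset C (add_mset ((C \<^bold>\<Rightarrow> E) \<^bold>\<Rightarrow> B) \<Gamma>)"
  show "add_mset E ?\<Xi> \<turnstile>\<^bsub>\<K>\<^esub> C \<^bold>\<Rightarrow> E"
    by (rule deriv_ImpR) (metis K_identity add_mset_commute)
  show "add_mset (E \<^bold>\<Rightarrow> B) ?\<Xi> \<turnstile>\<^bsub>\<K>\<^esub> E" using assms by (rule weakening) simp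
qed simp

lemma K_antecedent_of_D_rule:
  assumes "left_rule F \<D> L T S" "A \<^bold>\<Rightarrow> B \<in># L" "\<forall>(\<Delta>, H)\<in>T. \<Delta> + \<Gamma> \<turnstile>\<^bsub>\<K>\<^esub> H"
  shows "L + \<Gamma> \<turnstile>\<^bsub>\<K>\<^esub> A"
  using assms(1)
proof cases
  case (ImpL_axiom p ts B')
  then show ?thesis using assms(2) by (auto intro: deriv_axiom)
next
  case (ImpL_Top B')
  then show ?thesis using assms(2) by (simp add: deriv_TopR)
next
  case (ImpL_Conj C E B')
  then show ?thesis using assms(2,3) by (simp add: K_ImpL_Conj_antecedent)
next
  case (ImpL_Disj1 C E B')
  then show ?thesis using assms(2,3) by (simp add: deriv_DisjR1 K_ImpL_Disj_antecedent)
next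
  case (ImpL_Disj2 C E B')
  then show ?thesis using assms(2,3) by (simp add: deriv_DisjR2 K_ImpL_Disj_antecedent)
next
  case (ImpL_Imp C E B')
  then show ?thesis using assms(2,3) by (simp add: K_ImpL_Imp_antecedent)
next
  case (ImpL_All C B')
  then show ?thesis using assms(2,3) by (auto intro!: deriv_AllR)
next
  case (ImpL_Ex t C B')
  then show ?thesis using assms(2,3) by (auto intro: deriv_ExR)
qed (use assms(2) in simp_all)

lemma D_left_rule_admissible_K:
  assumes "left_rule F \<D> L T S" "\<forall>(\<Delta>, H)\<in>T. \<Delta> + \<Gamma> \<turnstile>\<^bsub>\<K>\<^esub> H" "\<forall>\<Delta>\<in>S. \<Delta> + \<Gamma> \<turnstile>\<^bsub>\<K>\<^esub> G"
  shows "L + \<Gamma> \<turnstile>\<^bsub>\<K>\<^esub> G"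
proof (cases "\<exists>A B. A \<^bold>\<Rightarrow> B \<in># L")
  case True
  then obtain A B where imp: "A \<^bold>\<Rightarrow> B \<in># L" by blast
  show ?thesis
  proof (rule K_cut)
    show "L + \<Gamma> \<turnstile>\<^bsub>\<K>\<^esub> B"
    proof (rule K_modus_ponens)
      show "A \<^bold>\<Rightarrow> B \<in># L + \<Gamma>" using imp by simp
      show "L + \<Gamma> \<turnstile>\<^bsub>\<K>\<^esub> A" using assms(1) imp assms(2) by (rule K_antecedent_of_D_rule)
    qed
    have "add_mset B (L - {#A \<^bold>\<Rightarrow> B#}) + \<Gamma> \<turnstile>\<^bsub>\<K>\<^esub> G"
      using assms(3) left_rule_imp_contexts[OF assms(1) imp] by blast
    then show "add_mset B (L + \<Gamma>) \<turnstile>\<^bsub>\<K>\<^esub> G" by (rule weakening) simp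
  qed
next
  case False
  with assms(1) have "left_rule F \<K> L T S" by (rule left_rule_non_imp)
  then show ?thesis using assms(2,3) by (rule deriv_left)
qed

theorem deriv_D_imp_K: "\<Gamma> \<turnstile>\<^bsub>\<D>\<^esub> G \<Longrightarrow> \<Gamma> \<turnstile>\<^bsub>\<K>\<^esub> G"
proof (induction rule: deriv_rules_induct)
  case (axiom p ts \<Gamma>)
  show ?case by (simp add: deriv_axiom)
next
  case (right G P \<Gamma>)
  then show ?case by (rule deriv_right)
next
  case (left L T S \<Gamma> G)
  then show ?case by (rule D_left_rule_admissible_K)
qed

section \<open>Admissibility of the left implication rule of \<open>\<K>\<close> in \<open>\<D>\<close>\<close>

definition contraction_admissible :: "('f, 'p) fm \<Rightarrow> bool" where
  "contraction_admissible A \<longleftrightarrow>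
    (\<forall>\<Gamma> G. add_mset A (add_mset A \<Gamma>) \<turnstile>\<^bsub>\<D>\<^esub> G \<longrightarrow> add_mset A \<Gamma> \<turnstile>\<^bsub>\<D>\<^esub> G)"

definition ImpL_admissible :: "('f, 'p) fm \<Rightarrow> bool" where
  "ImpL_admissible A \<longleftrightarrow>
    (\<forall>\<Gamma> B G. add_mset (A \<^bold>\<Rightarrow> B) \<Gamma> \<turnstile>\<^bsub>\<D>\<^esub> A \<longrightarrow> add_mset B \<Gamma> \<turnstile>\<^bsub>\<D>\<^esub> G \<longrightarrow> add_mset (A \<^bold>\<Rightarrow> B) \<Gamma> \<turnstile>\<^bsub>\<D>\<^esub> G)"

lemma contraction_admissible_mset:
  assumes "\<forall>A\<in>#\<Delta>. contraction_admissible A" "\<Delta> + \<Delta> + \<Gamma> \<turnstile>\<^bsub>\<D>\<^esub> G"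
  shows "\<Delta> + \<Gamma> \<turnstile>\<^bsub>\<D>\<^esub> G"
  using assms
proof (induction \<Delta> arbitrary: \<Gamma>)
  case (add A \<Delta>)
  have "\<Delta> + \<Delta> + add_mset A \<Gamma> \<turnstile>\<^bsub>\<D>\<^esub> G" using add.prems by (simp add: contraction_admissible_def)
  then show ?case using add.IH[of "add_mset A \<Gamma>"] add.prems(1) by simp
qed simp

text \<open>
  If one rule of \<open>\<D>\<close> replaces \<open>A \<^bold>\<Rightarrow> B\<close> by \<open>\<Delta>\<close> in a premise with its own succedent, then every rule
  with this principal formula has a premise with context \<open>\<Delta>\<close> and a succedent \<open>Y\<close> smaller than \<open>A\<close>
  such that \<open>Y \<^bold>\<Rightarrow> B \<in># \<Delta>\<close>.
\<close>

lemma D_side_context_replace: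
  fixes A :: "('f, 'p) fm"
  assumes rule: "left_rule F \<D> {#A \<^bold>\<Rightarrow> B#} T S" "(\<Delta>, Y) \<in> T" "A \<^bold>\<Rightarrow> B \<notin># \<Delta>"
    and adm: "\<And>Z :: ('f, 'p) fm. connectives Z < connectives A \<Longrightarrow> ImpL_admissible Z"
    and "add_mset (A \<^bold>\<Rightarrow> B) \<Gamma> \<turnstile>\<^bsub>\<D>\<^esub> G"
  shows "\<Delta> + \<Gamma> \<turnstile>\<^bsub>\<D>\<^esub> G"
  using assms(5)
proof (rule deriv_replace)
  fix L G P \<Gamma>
  assume inference: "inference \<D> L G P" "A \<^bold>\<Rightarrow> B \<in># L" and derivs: "\<forall>(\<Delta>, H)\<in>P. \<Delta> + \<Gamma> \<turnstile>\<^bsub>\<D>\<^esub> H"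
  obtain Y where Y: "L = {#A \<^bold>\<Rightarrow> B#}" "(\<Delta>, Y) \<in> P" "({#B#}, G) \<in> P" "Y \<^bold>\<Rightarrow> B \<in># \<Delta>"
      "connectives Y < connectives A"
    using inference rule by (auto elim!: inference.cases left_rule.cases)
  then obtain \<Xi> where \<Xi>: "\<Delta> = add_mset (Y \<^bold>\<Rightarrow> B) \<Xi>" by (metis insert_DiffM)
  have "add_mset (Y \<^bold>\<Rightarrow> B) (\<Xi> + \<Gamma>) \<turnstile>\<^bsub>\<D>\<^esub> Y" using derivs Y(2) \<Xi> by auto
  moreover have "{#B#} + \<Gamma> \<turnstile>\<^bsub>\<D>\<^esub> G" using derivs Y(3) by blast
  then have "add_mset B (\<Xi> + \<Gamma>) \<turnstile>\<^bsub>\<D>\<^esub> G" by (rule weakening) simp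
  ultimately have "add_mset (Y \<^bold>\<Rightarrow> B) (\<Xi> + \<Gamma>) \<turnstile>\<^bsub>\<D>\<^esub> G"
    using adm[OF Y(5)] unfolding ImpL_admissible_def by blast
  then show "L - {#A \<^bold>\<Rightarrow> B#} + \<Delta> + \<Gamma> \<turnstile>\<^bsub>\<D>\<^esub> G" using Y(1) \<Xi> by simp
qed

lemma D_premise_context_replace:
  fixes X :: "('f, 'p) fm"
  assumes "inference \<D> L G P" "X \<in># L" "(\<Delta>, H) \<in> P" "X \<notin># \<Delta>"
    and adm: "\<And>Z :: ('f, 'p) fm. connectives Z < connectives X \<Longrightarrow> ImpL_admissible Z"
    and X: "add_mset X \<Gamma> \<turnstile>\<^bsub>\<D>\<^esub> K"
  shows "\<Delta> + \<Gamma> \<turnstile>\<^bsub>\<D>\<^esub> K"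
  using assms(1)
proof cases
  case (left T S)
  with assms(3) consider (own) "(\<Delta>, H) \<in> T" | (kept) "\<Delta> \<in> S" by auto
  then show ?thesis
  proof cases
    case own
    then obtain A B where L: "L = {#A \<^bold>\<Rightarrow> B#}" and imp: "X = A \<^bold>\<Rightarrow> B"
      using left(2) assms(2) by (auto elim: left_rule.cases)
    have "ImpL_admissible Z" if "connectives Z < connectives A" for Z :: "('f, 'p) fm"
      by (rule adm) (use that imp in simp)
    with left(2)[unfolded L] own assms(4)[unfolded imp] show ?thesis
      using X[unfolded imp] by (rule D_side_context_replace)
  next
    case kept
    have "L + \<Gamma> \<turnstile>\<^bsub>\<D>\<^esub> K" using X by (rule weakening) (use assms(2) in simp)
    with left(2) kept show ?thesis by (rule left_rule_inversion)
  qed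
qed (use assms(2,3) in simp_all)

lemma D_premise_smaller:
  "inference \<D> L G P \<Longrightarrow> X \<in># L \<Longrightarrow> (\<Delta>, H) \<in> P \<Longrightarrow> X \<notin># \<Delta> \<Longrightarrow> Y \<in># \<Delta> \<Longrightarrow>
    connectives Y < connectives X"
  by (auto elim!: inference.cases left_rule.cases)

lemma principal_once:
  assumes "inference c L G P" "X \<in># L"
  obtains M where "L = add_mset X M" "X \<notin># M"
proof
  show "L = add_mset X (L - {#X#})" using assms(2) by simp
  show "X \<notin># L - {#X#}"
    using assms(1)
    by (auto elim!: inference.cases left_rule.cases simp: in_diff_count split: if_splits)
qed

lemma D_premise_contraction:
  fixes X :: "('f, 'p) fm"
  assumes premise: "inference \<D> L G P" "X \<in># L" "(\<Delta>, H) \<in> P" "X \<notin># \<Delta>"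
    and contraction: "\<And>Y :: ('f, 'p) fm. connectives Y < connectives X \<Longrightarrow> contraction_admissible Y"
    and ImpL: "\<And>Y :: ('f, 'p) fm. connectives Y < connectives X \<Longrightarrow> ImpL_admissible Y"
    and "add_mset X (\<Delta> + \<Gamma>) \<turnstile>\<^bsub>\<D>\<^esub> H"
  shows "\<Delta> + \<Gamma> \<turnstile>\<^bsub>\<D>\<^esub> H"
proof (rule contraction_admissible_mset)
  show "\<forall>Y\<in>#\<Delta>. contraction_admissible Y" using contraction D_premise_smaller[OF premise] by blast
  have "\<Delta> + (\<Delta> + \<Gamma>) \<turnstile>\<^bsub>\<D>\<^esub> H" using premise ImpL assms(7) by (rule D_premise_context_replace)
  then show "\<Delta> + \<Delta> + \<Gamma> \<turnstile>\<^bsub>\<D>\<^esub> H" by (simp add: add.assoc)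
qed

lemma contraction_principal:
  fixes X :: "('f, 'p) fm"
  assumes rule: "inference \<D> L G P" "X \<in># L" "L + \<Gamma>' = add_mset X (add_mset X \<Gamma>)"
    and derivs: "\<forall>(\<Delta>, H)\<in>P. \<Delta> + \<Gamma>' \<turnstile>\<^bsub>\<D>\<^esub> H"
    and contract_premise: "\<And>\<Xi> H \<Delta>. (\<Xi>, H) \<in> P \<Longrightarrow> \<Xi> + \<Gamma>' = add_mset X (add_mset X \<Delta>) \<Longrightarrow>
      add_mset X \<Delta> \<turnstile>\<^bsub>\<D>\<^esub> H"
    and contraction: "\<And>Y :: ('f, 'p) fm. connectives Y < connectives X \<Longrightarrow> contraction_admissible Y"
    and ImpL: "\<And>Y :: ('f, 'p) fm. connectives Y < connectives X \<Longrightarrow> ImpL_admissible Y"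
  shows "add_mset X \<Gamma> \<turnstile>\<^bsub>\<D>\<^esub> G"
proof -
  from rule(1,2) obtain M where L: "L = add_mset X M" and "X \<notin># M" by (rule principal_once)
  then have "M + \<Gamma>' = add_mset X \<Gamma>" using rule(3) by simp
  then obtain \<Xi> where \<Xi>: "\<Gamma>' = add_mset X \<Xi>" "\<Gamma> = M + \<Xi>"
    using \<open>X \<notin># M\<close> by (rule add_mset_eq_union_notin)
  have "\<Delta> + \<Xi> \<turnstile>\<^bsub>\<D>\<^esub> H" if premise: "(\<Delta>, H) \<in> P" for \<Delta> H
  proof (cases "X \<in># \<Delta>")
    case True
    then obtain \<Delta>' where "\<Delta> = add_mset X \<Delta>'" by (metis insert_DiffM)
    then show ?thesis using contract_premise[OF premise, of "\<Delta>' + \<Xi>"] \<Xi>(1) by simp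
  next
    case False
    have "add_mset X (\<Delta> + \<Xi>) \<turnstile>\<^bsub>\<D>\<^esub> H" using derivs premise \<Xi>(1) by auto
    with rule(1,2) premise False contraction ImpL show ?thesis
      by (rule D_premise_contraction)
  qed
  then have "L + \<Xi> \<turnstile>\<^bsub>\<D>\<^esub> G" by (intro deriv.infer[OF rule(1)]) auto
  then show ?thesis using L \<Xi>(2) by simp
qed

lemma contraction_admissible_step:
  fixes X :: "('f, 'p) fm"
  assumes contraction: "\<And>Y :: ('f, 'p) fm. connectives Y < connectives X \<Longrightarrow> contraction_admissible Y"
    and ImpL: "\<And>Y :: ('f, 'p) fm. connectives Y < connectives X \<Longrightarrow> ImpL_admissible Y"
  shows "contraction_admissible X"
proof -
  have "add_mset X \<Gamma> \<turnstile>\<^bsub>\<D>\<^esub> G" if "add_mset X (add_mset X \<Gamma>) \<turnstile>\<^bsub>\<D>\<^esub> G" for \<Gamma> G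
    using that
  proof (induction "add_mset X (add_mset X \<Gamma>)" G arbitrary: \<Gamma> rule: deriv.induct)
    case (infer L G P \<Gamma>')
    have derivs: "\<forall>(\<Delta>, H)\<in>P. \<Delta> + \<Gamma>' \<turnstile>\<^bsub>\<D>\<^esub> H" using infer.hyps(2) by auto
    have contract_premise: "add_mset X \<Delta> \<turnstile>\<^bsub>\<D>\<^esub> H"
      if "(\<Xi>, H) \<in> P" "\<Xi> + \<Gamma>' = add_mset X (add_mset X \<Delta>)" for \<Xi> H \<Delta>
      using infer.hyps(2) that by auto
    show ?case
    proof (cases "X \<in># L")
      case True
      from infer.hyps(1) True infer.hyps(3) derivs contract_premise contraction ImpL show ?thesis
        by (rule contraction_principal)
    next
      case False
      with infer.hyps(3) obtain \<Xi> where \<Xi>: "\<Gamma>' = add_mset X \<Xi>" "add_mset X \<Gamma> = L + \<Xi>"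
        by (rule add_mset_eq_union_notin)
      from \<Xi>(2)[symmetric] False obtain \<Theta> where "\<Xi> = add_mset X \<Theta>"
        by (rule add_mset_eq_union_notin)
      then have "\<Delta> + \<Xi> \<turnstile>\<^bsub>\<D>\<^esub> H" if "(\<Delta>, H) \<in> P" for \<Delta> H
        using contract_premise[OF that, of "\<Delta> + \<Theta>"] \<Xi>(1) by simp
      then show ?thesis unfolding \<Xi>(2) by (intro deriv.infer[OF infer.hyps(1)]) auto
    qed
  qed
  then show ?thesis by (simp add: contraction_admissible_def)
qed

lemma D_left_rule_matching_right_rule:
  assumes "right_rule F A P"
  obtains T where "left_rule F \<D> {#A \<^bold>\<Rightarrow> B#} T {{#B#}}"
    and "\<forall>(\<Delta>, Y)\<in>T. \<exists>\<Xi>. (\<Xi>, Y) \<in> P \<and> (\<Delta> = {#A \<^bold>\<Rightarrow> B#} \<and> \<Xi> = {#} \<or>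
      A \<^bold>\<Rightarrow> B \<notin># \<Delta> \<and> \<Xi> \<subseteq># \<Delta> \<and> (\<forall>Z\<in>#\<Xi>. connectives Z < connectives A))"
  using assms
proof cases
  case TopR
  from ImpL_Top show ?thesis by (rule that[unfolded TopR]) auto
next
  case (ConjR C E)
  from ImpL_Conj show ?thesis by (rule that[unfolded ConjR]) auto
next
  case (DisjR1 C E)
  from ImpL_Disj1 show ?thesis by (rule that[unfolded DisjR1]) auto
next
  case (DisjR2 C E)
  from ImpL_Disj2 show ?thesis by (rule that[unfolded DisjR2]) auto
next
  case (ImpR C E)
  from ImpL_Imp show ?thesis by (rule that[unfolded ImpR]) auto
next
  case (AllR C)
  from ImpL_All show ?thesis by (rule that[unfolded AllR]) auto
next
  case (ExR t C)
  from ImpL_Ex[OF ExR(3)] show ?thesis by (rule that[unfolded ExR(1,2)]) auto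
qed

lemma ImpL_admissible_introduction:
  fixes A :: "('f, 'p) fm"
  assumes contraction: "\<And>Y :: ('f, 'p) fm. connectives Y < connectives A \<Longrightarrow> contraction_admissible Y"
    and ImpL: "\<And>Y :: ('f, 'p) fm. connectives Y < connectives A \<Longrightarrow> ImpL_admissible Y"
    and right: "right_rule F A P" "\<forall>(\<Delta>, H)\<in>P. \<Delta> + add_mset (A \<^bold>\<Rightarrow> B) \<Gamma> \<turnstile>\<^bsub>\<D>\<^esub> H"
    and "add_mset B \<Gamma> \<turnstile>\<^bsub>\<D>\<^esub> G"
  shows "add_mset (A \<^bold>\<Rightarrow> B) \<Gamma> \<turnstile>\<^bsub>\<D>\<^esub> G"
proof -
  obtain T where rule: "left_rule F \<D> {#A \<^bold>\<Rightarrow> B#} T {{#B#}}"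
    and matching: "\<forall>(\<Delta>, Y)\<in>T. \<exists>\<Xi>. (\<Xi>, Y) \<in> P \<and> (\<Delta> = {#A \<^bold>\<Rightarrow> B#} \<and> \<Xi> = {#} \<or>
      A \<^bold>\<Rightarrow> B \<notin># \<Delta> \<and> \<Xi> \<subseteq># \<Delta> \<and> (\<forall>Z\<in>#\<Xi>. connectives Z < connectives A))"
    using right(1) by (rule D_left_rule_matching_right_rule)
  have "\<Delta> + \<Gamma> \<turnstile>\<^bsub>\<D>\<^esub> Y" if "(\<Delta>, Y) \<in> T" for \<Delta> Y
  proof -
    obtain \<Xi> where \<Xi>: "(\<Xi>, Y) \<in> P" and "\<Delta> = {#A \<^bold>\<Rightarrow> B#} \<and> \<Xi> = {#} \<or>
        A \<^bold>\<Rightarrow> B \<notin># \<Delta> \<and> \<Xi> \<subseteq># \<Delta> \<and> (\<forall>Z\<in>#\<Xi>. connectives Z < connectives A)"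
      using matching \<open>(\<Delta>, Y) \<in> T\<close> by blast
    then consider (principal_kept) "\<Delta> = {#A \<^bold>\<Rightarrow> B#}" "\<Xi> = {#}"
      | (principal_replaced) "A \<^bold>\<Rightarrow> B \<notin># \<Delta>" "\<Xi> \<subseteq># \<Delta>" "\<forall>Z\<in>#\<Xi>. connectives Z < connectives A"
      by blast
    then show ?thesis
    proof cases
      case principal_kept
      then show ?thesis using right(2) \<Xi> by auto
    next
      case principal_replaced
      then obtain \<Theta> where \<Theta>: "\<Delta> = \<Xi> + \<Theta>" by (metis subset_mset.le_iff_add)
      have "add_mset (A \<^bold>\<Rightarrow> B) (\<Xi> + \<Gamma>) \<turnstile>\<^bsub>\<D>\<^esub> Y" using right(2) \<Xi> by auto
      with rule \<open>(\<Delta>, Y) \<in> T\<close> principal_replaced(1) ImpL have "\<Delta> + (\<Xi> + \<Gamma>) \<turnstile>\<^bsub>\<D>\<^esub> Y"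
        by (rule D_side_context_replace)
      then have "\<Xi> + \<Xi> + (\<Theta> + \<Gamma>) \<turnstile>\<^bsub>\<D>\<^esub> Y" using \<Theta> by (simp add: ac_simps)
      moreover have "\<forall>Z\<in>#\<Xi>. contraction_admissible Z"
        using principal_replaced(3) contraction by blast
      ultimately show ?thesis using contraction_admissible_mset[of \<Xi> "\<Theta> + \<Gamma>" Y] \<Theta>
        by (simp add: add.assoc)
    qed
  qed
  then have "{#A \<^bold>\<Rightarrow> B#} + \<Gamma> \<turnstile>\<^bsub>\<D>\<^esub> G"
    using assms(5) by (intro deriv_left[OF rule]) auto
  then show ?thesis by simp
qed

lemma left_rule_imp_inversion:
  assumes "left_rule F c L T S" "\<Delta> \<in> S" "L + \<Xi> = add_mset (A \<^bold>\<Rightarrow> B) \<Theta>" "add_mset B \<Theta> \<turnstile>\<^bsub>c\<^esub> G"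
  shows "\<Delta> + \<Xi> \<turnstile>\<^bsub>c\<^esub> G \<or> (\<exists>\<Lambda>. \<Delta> + \<Xi> = add_mset (A \<^bold>\<Rightarrow> B) \<Lambda> \<and> add_mset B \<Lambda> \<turnstile>\<^bsub>c\<^esub> G)"
proof (cases "A \<^bold>\<Rightarrow> B \<in># L")
  case True
  then have "\<Delta> = add_mset B (L - {#A \<^bold>\<Rightarrow> B#})"
    using left_rule_imp_contexts[OF assms(1)] assms(2) by blast
  then show ?thesis using add_mset_eq_union_in[OF assms(3) True] assms(4) by simp
next
  case False
  with assms(3) obtain \<Lambda> where \<Lambda>: "\<Xi> = add_mset (A \<^bold>\<Rightarrow> B) \<Lambda>" "\<Theta> = L + \<Lambda>"
    by (rule add_mset_eq_union_notin)
  have "L + add_mset B \<Lambda> \<turnstile>\<^bsub>c\<^esub> G" using assms(4) \<Lambda>(2) by simp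
  with assms(1,2) have "\<Delta> + add_mset B \<Lambda> \<turnstile>\<^bsub>c\<^esub> G" by (rule left_rule_inversion)
  then show ?thesis using \<Lambda>(1) by simp
qed

lemma ImpL_admissible_step:
  fixes A :: "('f, 'p) fm"
  assumes contraction: "\<And>Y :: ('f, 'p) fm. connectives Y < connectives A \<Longrightarrow> contraction_admissible Y"
    and ImpL: "\<And>Y :: ('f, 'p) fm. connectives Y < connectives A \<Longrightarrow> ImpL_admissible Y"
  shows "ImpL_admissible A"
proof -
  have "add_mset (A \<^bold>\<Rightarrow> B) \<Gamma> \<turnstile>\<^bsub>\<D>\<^esub> G"
    if A: "add_mset (A \<^bold>\<Rightarrow> B) \<Gamma> \<turnstile>\<^bsub>\<D>\<^esub> A" and B: "add_mset B \<Gamma> \<turnstile>\<^bsub>\<D>\<^esub> G" for B \<Gamma> G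
  proof -
    define reducible where "reducible \<Xi> \<longleftrightarrow>
        \<Xi> \<turnstile>\<^bsub>\<D>\<^esub> G \<or> (\<exists>\<Theta>. \<Xi> = add_mset (A \<^bold>\<Rightarrow> B) \<Theta> \<and> add_mset B \<Theta> \<turnstile>\<^bsub>\<D>\<^esub> G)" for \<Xi>
    have "reducible (add_mset (A \<^bold>\<Rightarrow> B) \<Gamma>)" using B by (auto simp: reducible_def)
    with A show ?thesis
    proof (rule deriv_reduce_to_introduction)
      show "reducible (\<Delta> + \<Xi>)" if "left_rule F \<D> L T S" "\<Delta> \<in> S" "reducible (L + \<Xi>)" for L T S \<Delta> \<Xi>
        using that(3) left_rule_inversion[OF that(1,2)] left_rule_imp_inversion[OF that(1,2)]
        unfolding reducible_def by blast
    next
      fix p ts \<Xi> assume atom: "A = Atom p ts" and "reducible (add_mset A \<Xi>)"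
      then consider "add_mset A \<Xi> \<turnstile>\<^bsub>\<D>\<^esub> G"
        | \<Lambda> where "\<Xi> = add_mset (A \<^bold>\<Rightarrow> B) \<Lambda>" "add_mset A (add_mset B \<Lambda>) \<turnstile>\<^bsub>\<D>\<^esub> G"
        by (auto simp: reducible_def add_eq_conv_ex add_mset_commute)
      then show "add_mset A \<Xi> \<turnstile>\<^bsub>\<D>\<^esub> G" using atom by cases (simp_all add: deriv_D_ImpL_axiom)
    next
      fix P \<Xi> assume right: "right_rule F A P" "\<forall>(\<Delta>, H)\<in>P. \<Delta> + \<Xi> \<turnstile>\<^bsub>\<D>\<^esub> H" and "reducible \<Xi>"
      then consider (derived) "\<Xi> \<turnstile>\<^bsub>\<D>\<^esub> G"
        | (hypothesis) \<Theta> where "\<Xi> = add_mset (A \<^bold>\<Rightarrow> B) \<Theta>" "add_mset B \<Theta> \<turnstile>\<^bsub>\<D>\<^esub> G"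
        by (auto simp: reducible_def)
      then show "\<Xi> \<turnstile>\<^bsub>\<D>\<^esub> G"
      proof cases
        case (hypothesis \<Theta>)
        note right = right[unfolded hypothesis(1)]
        show ?thesis unfolding hypothesis(1)
          using contraction ImpL right hypothesis(2) by (rule ImpL_admissible_introduction)
      qed
    qed
  qed
  then show ?thesis by (simp add: ImpL_admissible_def)
qed

lemma contraction_and_ImpL_admissible: "contraction_admissible A \<and> ImpL_admissible A"
proof (induction A rule: measure_induct_rule[of connectives])
  case (less A)
  have "contraction_admissible A" by (rule contraction_admissible_step) (use less in blast)+
  moreover have "ImpL_admissible A" by (rule ImpL_admissible_step) (use less in blast)+
  ultimately show ?case ..
qed

theorem deriv_K_imp_D: "\<Gamma> \<turnstile>\<^bsub>\<K>\<^esub> G \<Longrightarrow> \<Gamma> \<turnstile>\<^bsub>\<D>\<^esub> G"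
proof (induction rule: deriv_rules_induct)
  case (axiom p ts \<Gamma>)
  show ?case by (simp add: deriv_axiom)
next
  case (right G P \<Gamma>)
  then show ?case by (rule deriv_right)
next
  case (left L T S \<Gamma> G)
  show ?case
  proof (cases "\<exists>A B. A \<^bold>\<Rightarrow> B \<in># L")
    case True
    then obtain A B where "A \<^bold>\<Rightarrow> B \<in># L" by blast
    note left_rule_K_imp[OF left(1) this]
    then show ?thesis using left(2,3) contraction_and_ImpL_admissible[of A]
      by (simp add: ImpL_admissible_def)
  next
    case False
    with left(1) have "left_rule F \<D> L T S" by (rule left_rule_non_imp)
    then show ?thesis using left(2,3) by (rule deriv_left)
  qed
qed

section \<open>Eigenvariables\<close>

definition derivable_instances ::
    "calculus \<Rightarrow> ('f, 'p) fm multiset \<Rightarrow> ('f, 'p) fm \<Rightarrow> bool" where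
  "derivable_instances c \<Gamma> G \<longleftrightarrow>
    (\<forall>s. (\<forall>n. wf_tm F (s n)) \<longrightarrow> image_mset (subst_fm s) \<Gamma> \<turnstile>\<^bsub>c\<^esub> subst_fm s G)"

lemma derivable_instancesI:
  "(\<And>s. \<forall>n. wf_tm F (s n) \<Longrightarrow> image_mset (subst_fm s) \<Gamma> \<turnstile>\<^bsub>c\<^esub> subst_fm s G) \<Longrightarrow>
    derivable_instances c \<Gamma> G"
  by (simp add: derivable_instances_def)

lemma derivable_instancesD:
  "derivable_instances c \<Gamma> G \<Longrightarrow> \<forall>n. wf_tm F (s n) \<Longrightarrow> image_mset (subst_fm s) \<Gamma> \<turnstile>\<^bsub>c\<^esub> subst_fm s G"
  by (simp add: derivable_instances_def)

lemma derivable_instances_upd: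
  assumes "derivable_instances c \<Gamma> G" "\<forall>n. wf_tm F (s n)" "wf_tm F t"
  shows "image_mset (subst_fm (s(x := t))) \<Gamma> \<turnstile>\<^bsub>c\<^esub> subst_fm (s(x := t)) G"
  using assms by (simp add: derivable_instancesD)

lemma derivable_instances_imp_deriv:
  fixes G :: "('f, 'p) fm"
  assumes "derivable_instances c \<Gamma> G"
  shows "\<Gamma> \<turnstile>\<^bsub>c\<^esub> G"
proof -
  have "subst_fm Var = (\<lambda>A :: ('f, 'p) fm. A)" by (rule ext) (rule subst_fm_Var)
  then show ?thesis using derivable_instancesD[OF assms, of Var] by simp
qed

lemma derivable_instances_AllR:
  assumes "derivable_instances c \<Gamma> A" "x \<notin> fv_ctx \<Gamma>"
  shows "derivable_instances c \<Gamma> (all x A)"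
proof (rule derivable_instancesI)
  fix s :: "nat \<Rightarrow> 'f tm"
  assume s: "\<forall>n. wf_tm F (s n)"
  have "image_mset (subst_fm s) \<Gamma> \<turnstile>\<^bsub>c\<^esub> subst_fm (s(x := t)) A" if "wf_tm F t" for t
    using derivable_instances_upd[OF assms(1) s that, of x] assms(2)
    by (simp add: subst_ctx_upd_fresh)
  then show "image_mset (subst_fm s) \<Gamma> \<turnstile>\<^bsub>c\<^esub> subst_fm s (all x A)"
    by (simp add: all_def deriv_AllR instantiate_subst_bind)
qed

lemma derivable_instances_AllL:
  assumes "derivable_instances c (add_mset (all x A) (add_mset (inst t x A) \<Gamma>)) G" "wf_tm F t"
  shows "derivable_instances c (add_mset (all x A) \<Gamma>) G"
proof (rule derivable_instancesI)
  fix s :: "nat \<Rightarrow> 'f tm"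
  assume s: "\<forall>n. wf_tm F (s n)"
  let ?B = "subst_fm (lift_subst s) (bind x A)"
  have "add_mset (Forall ?B) (add_mset (instantiate (subst_tm s t) ?B)
      (image_mset (subst_fm s) \<Gamma>)) \<turnstile>\<^bsub>c\<^esub> subst_fm s G"
    using derivable_instancesD[OF assms(1) s]
    by (simp add: all_def subst_fm_inst instantiate_subst_bind)
  then have "add_mset (Forall ?B) (image_mset (subst_fm s) \<Gamma>) \<turnstile>\<^bsub>c\<^esub> subst_fm s G"
    using wf_tm_subst_tm[OF assms(2) s] by (rule deriv_AllL)
  then show "image_mset (subst_fm s) (add_mset (all x A) \<Gamma>) \<turnstile>\<^bsub>c\<^esub> subst_fm s G"
    by (simp add: all_def)
qed

lemma derivable_instances_ExL:
  assumes "derivable_instances c (add_mset A \<Gamma>) G" "x \<notin> fv_ctx \<Gamma> \<union> fv G"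
  shows "derivable_instances c (add_mset (ex x A) \<Gamma>) G"
proof (rule derivable_instancesI)
  fix s :: "nat \<Rightarrow> 'f tm"
  assume s: "\<forall>n. wf_tm F (s n)"
  have "add_mset (subst_fm (s(x := t)) A) (image_mset (subst_fm s) \<Gamma>) \<turnstile>\<^bsub>c\<^esub> subst_fm s G"
    if "wf_tm F t" for t
    using derivable_instances_upd[OF assms(1) s that, of x] assms(2)
    by (simp add: subst_ctx_upd_fresh subst_fm_upd_fresh)
  then show "image_mset (subst_fm s) (add_mset (ex x A) \<Gamma>) \<turnstile>\<^bsub>c\<^esub> subst_fm s G"
    by (simp add: ex_def deriv_ExL instantiate_subst_bind)
qed

lemma derivable_instances_ExR:
  assumes "derivable_instances c \<Gamma> (inst t x A)" "wf_tm F t"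
  shows "derivable_instances c \<Gamma> (ex x A)"
proof (rule derivable_instancesI)
  fix s :: "nat \<Rightarrow> 'f tm"
  assume s: "\<forall>n. wf_tm F (s n)"
  let ?B = "subst_fm (lift_subst s) (bind x A)"
  have "image_mset (subst_fm s) \<Gamma> \<turnstile>\<^bsub>c\<^esub> instantiate (subst_tm s t) ?B"
    using derivable_instancesD[OF assms(1) s] by (simp add: subst_fm_inst instantiate_subst_bind)
  then have "image_mset (subst_fm s) \<Gamma> \<turnstile>\<^bsub>c\<^esub> Exists ?B"
    using wf_tm_subst_tm[OF assms(2) s] by (rule deriv_ExR)
  then show "image_mset (subst_fm s) \<Gamma> \<turnstile>\<^bsub>c\<^esub> subst_fm s (ex x A)"
    by (simp add: ex_def)
qed

lemma derivable_instances_ImpL_All: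
  assumes "derivable_instances \<D> (add_mset (all x C \<^bold>\<Rightarrow> B) \<Gamma>) C"
    and "derivable_instances \<D> (add_mset B \<Gamma>) G" and "x \<notin> fv_ctx \<Gamma> \<union> fv B"
  shows "derivable_instances \<D> (add_mset (all x C \<^bold>\<Rightarrow> B) \<Gamma>) G"
proof (rule derivable_instancesI)
  fix s :: "nat \<Rightarrow> 'f tm"
  assume s: "\<forall>n. wf_tm F (s n)"
  have "x \<notin> fv (all x C)" by (simp add: fv_all)
  then have "add_mset (subst_fm s (all x C) \<^bold>\<Rightarrow> subst_fm s B) (image_mset (subst_fm s) \<Gamma>) \<turnstile>\<^bsub>\<D>\<^esub>
      subst_fm (s(x := t)) C" if "wf_tm F t" for t
    using derivable_instances_upd[OF assms(1) s that, of x] assms(3)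
    by (simp add: subst_ctx_upd_fresh subst_fm_upd_fresh)
  then show "image_mset (subst_fm s) (add_mset (all x C \<^bold>\<Rightarrow> B) \<Gamma>) \<turnstile>\<^bsub>\<D>\<^esub> subst_fm s G"
    using derivable_instancesD[OF assms(2) s]
    by (simp add: all_def deriv_D_ImpL_All instantiate_subst_bind)
qed

lemma derivable_instances_ImpL_Ex:
  assumes "derivable_instances \<D> (add_mset (ex x C \<^bold>\<Rightarrow> B) \<Gamma>) (inst t x C)" "wf_tm F t"
    and "derivable_instances \<D> (add_mset B \<Gamma>) G"
  shows "derivable_instances \<D> (add_mset (ex x C \<^bold>\<Rightarrow> B) \<Gamma>) G"
proof (rule derivable_instancesI)
  fix s :: "nat \<Rightarrow> 'f tm"
  assume s: "\<forall>n. wf_tm F (s n)"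
  let ?E = "subst_fm (lift_subst s) (bind x C)"
  have "add_mset (Exists ?E \<^bold>\<Rightarrow> subst_fm s B) (image_mset (subst_fm s) \<Gamma>) \<turnstile>\<^bsub>\<D>\<^esub>
      instantiate (subst_tm s t) ?E"
    using derivable_instancesD[OF assms(1) s]
    by (simp add: ex_def subst_fm_inst instantiate_subst_bind)
  moreover note wf_tm_subst_tm[OF assms(2) s]
  moreover have "add_mset (subst_fm s B) (image_mset (subst_fm s) \<Gamma>) \<turnstile>\<^bsub>\<D>\<^esub> subst_fm s G"
    using derivable_instancesD[OF assms(3) s] by simp
  ultimately
  have "add_mset (Exists ?E \<^bold>\<Rightarrow> subst_fm s B) (image_mset (subst_fm s) \<Gamma>) \<turnstile>\<^bsub>\<D>\<^esub> subst_fm s G"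
    by (rule deriv_D_ImpL_Ex)
  then show "image_mset (subst_fm s) (add_mset (ex x C \<^bold>\<Rightarrow> B) \<Gamma>) \<turnstile>\<^bsub>\<D>\<^esub> subst_fm s G"
    by (simp add: ex_def)
qed

lemma derivK_imp_derivable_instances: "derivK F \<Gamma> G \<Longrightarrow> derivable_instances \<K> \<Gamma> G"
proof (induction rule: derivK.induct)
  case (K_AllR \<Gamma> A x)
  then show ?case by (blast intro: derivable_instances_AllR)
next
  case (K_AllL x A t \<Gamma> G)
  then show ?case by (blast intro: derivable_instances_AllL)
next
  case (K_ExL A \<Gamma> G x)
  then show ?case by (blast intro: derivable_instances_ExL)
next
  case (K_ExR \<Gamma> t x A)
  then show ?case by (blast intro: derivable_instances_ExR)
qed (simp_all add: derivable_instances_def deriv_axiom deriv_TopR deriv_BotL deriv_ConjL deriv_ConjR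
  deriv_DisjL deriv_DisjR1 deriv_DisjR2 deriv_ImpR deriv_K_ImpL)

lemma derivD_imp_derivable_instances: "derivD F \<Gamma> G \<Longrightarrow> derivable_instances \<D> \<Gamma> G"
proof (induction rule: derivD.induct)
  case (D_AllR \<Gamma> A x)
  then show ?case by (blast intro: derivable_instances_AllR)
next
  case (D_AllL x A t \<Gamma> G)
  then show ?case by (blast intro: derivable_instances_AllL)
next
  case (D_ExL A \<Gamma> G x)
  then show ?case by (blast intro: derivable_instances_ExL)
next
  case (D_ExR \<Gamma> t x A)
  then show ?case by (blast intro: derivable_instances_ExR)
next
  case (D_ImpL_All x C B \<Gamma> G)
  then show ?case by (blast intro: derivable_instances_ImpL_All)
next
  case (D_ImpL_Ex x C B \<Gamma> t G)
  then show ?case by (blast intro: derivable_instances_ImpL_Ex)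
qed (simp_all add: derivable_instances_def deriv_axiom deriv_TopR deriv_BotL deriv_ConjL deriv_ConjR
  deriv_DisjL deriv_DisjR1 deriv_DisjR2 deriv_ImpR deriv_D_ImpL_axiom deriv_D_ImpL_Top
  deriv_D_ImpL_Conj deriv_D_ImpL_Disj1 deriv_D_ImpL_Disj2 deriv_D_ImpL_Imp)

interpretation K: common_rules F "derivK F"
  by standard (fact derivK.intros)+

interpretation D: common_rules F "derivD F"
  by standard (fact derivD.intros)+

lemma derivD_ImpL_Forall:
  assumes "\<forall>t. wf_tm F t \<longrightarrow> derivD F (add_mset (Forall C \<^bold>\<Rightarrow> B) \<Gamma>) (instantiate t C)"
    and "derivD F (add_mset B \<Gamma>) G"
  shows "derivD F (add_mset (Forall C \<^bold>\<Rightarrow> B) \<Gamma>) G"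
proof -
  have "finite (fv_ctx \<Gamma> \<union> fv B)" by (simp add: finite_fv finite_fv_ctx)
  then obtain x A where "C = bind x A" "x \<notin> fv_ctx \<Gamma> \<union> fv B" by (rule fresh_bind)
  then show ?thesis using D_ImpL_All[of F x A B \<Gamma> G] assms(1)[rule_format, of "Var x"] assms(2)
    by (simp add: all_def instantiate_bind inst_Var_same)
qed

lemma derivD_ImpL_Exists:
  assumes "derivD F (add_mset (Exists C \<^bold>\<Rightarrow> B) \<Gamma>) (instantiate t C)" "wf_tm F t"
    and "derivD F (add_mset B \<Gamma>) G"
  shows "derivD F (add_mset (Exists C \<^bold>\<Rightarrow> B) \<Gamma>) G"
proof -
  obtain x A where "C = bind x A" by (rule fresh_bind[OF finite.emptyI])
  then show ?thesis using D_ImpL_Ex[of F x A B \<Gamma> t G] assms by (simp add: ex_def instantiate_bind)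
qed

lemma derivK_left_rule:
  assumes "left_rule F \<K> L T S" "\<forall>(\<Delta>, H)\<in>T. derivK F (\<Delta> + \<Gamma>) H" "\<forall>\<Delta>\<in>S. derivK F (\<Delta> + \<Gamma>) G"
  shows "derivK F (L + \<Gamma>) G"
proof (cases "\<exists>A B. A \<^bold>\<Rightarrow> B \<in># L")
  case True
  then obtain A B where "A \<^bold>\<Rightarrow> B \<in># L" by blast
  note left_rule_K_imp[OF assms(1) this]
  then show ?thesis using assms(2,3) by (simp add: K_ImpL)
next
  case False
  with assms(1,3) show ?thesis by (blast intro: K.non_imp_left_rule_admissible)
qed

lemma derivD_left_rule:
  assumes "left_rule F \<D> L T S" "\<forall>(\<Delta>, H)\<in>T. derivD F (\<Delta> + \<Gamma>) H" "\<forall>\<Delta>\<in>S. derivD F (\<Delta> + \<Gamma>) G"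
  shows "derivD F (L + \<Gamma>) G"
proof (cases "\<exists>A B. A \<^bold>\<Rightarrow> B \<in># L")
  case True
  from assms(1) show ?thesis
  proof cases
    case (ImpL_All C B)
    have "\<forall>t. wf_tm F t \<longrightarrow> derivD F (add_mset (Forall C \<^bold>\<Rightarrow> B) \<Gamma>) (instantiate t C)"
      using assms(2) ImpL_All by auto
    then show ?thesis using derivD_ImpL_Forall assms(3) ImpL_All by simp
  next
    case (ImpL_Ex t C B)
    then show ?thesis using derivD_ImpL_Exists[of C B \<Gamma> t G] assms(2,3) by simp
  qed (use True assms(2,3) in \<open>simp_all add: D_ImpL_axiom D_ImpL_Top D_ImpL_Conj D_ImpL_Disj1
    D_ImpL_Disj2 D_ImpL_Imp\<close>)
next
  case False
  with assms(1,3) show ?thesis by (blast intro: D.non_imp_left_rule_admissible)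
qed

lemma derivK_iff_deriv: "derivK F \<Gamma> G \<longleftrightarrow> \<Gamma> \<turnstile>\<^bsub>\<K>\<^esub> G"
proof
  show "\<Gamma> \<turnstile>\<^bsub>\<K>\<^esub> G" if "derivK F \<Gamma> G"
    using derivable_instances_imp_deriv[OF derivK_imp_derivable_instances[OF that]] .
  show "derivK F \<Gamma> G" if "\<Gamma> \<turnstile>\<^bsub>\<K>\<^esub> G"
    using that
  proof (induction rule: deriv_rules_induct)
    case (axiom p ts \<Gamma>)
    show ?case by (rule K_axiom)
  next
    case (right G P \<Gamma>)
    then show ?case by (rule K.right_rule_admissible)
  next
    case (left L T S \<Gamma> G)
    then show ?case by (rule derivK_left_rule)
  qed
qed

lemma derivD_iff_deriv: "derivD F \<Gamma> G \<longleftrightarrow> \<Gamma> \<turnstile>\<^bsub>\<D>\<^esub> G"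
proof
  show "\<Gamma> \<turnstile>\<^bsub>\<D>\<^esub> G" if "derivD F \<Gamma> G"
    using derivable_instances_imp_deriv[OF derivD_imp_derivable_instances[OF that]] .
  show "derivD F \<Gamma> G" if "\<Gamma> \<turnstile>\<^bsub>\<D>\<^esub> G"
    using that
  proof (induction rule: deriv_rules_induct)
    case (axiom p ts \<Gamma>)
    show ?case by (rule D_axiom)
  next
    case (right G P \<Gamma>)
    then show ?case by (rule D.right_rule_admissible)
  next
    case (left L T S \<Gamma> G)
    then show ?case by (rule derivD_left_rule)
  qed
qed

end

theorem theorem6:
  fixes F :: "('f \<times> nat) set" and P :: "('p \<times> nat) set"
    and \<Gamma> :: "('f, 'p) fm multiset" and G :: "('f, 'p) fm"
  assumes "\<forall>A\<in>#\<Gamma>. wf_fm F P A" and "wf_fm F P G"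
  shows "derivD F \<Gamma> G \<longleftrightarrow> derivK F \<Gamma> G"
  unfolding derivD_iff_deriv derivK_iff_deriv by (blast intro: deriv_D_imp_K deriv_K_imp_D)

end
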